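(* Let $N$ be a simply connected 2-step nilpotent Lie group with left-invariant pseudo-Riemannian metric tensor. Then $I^{spl}(N)\le I^{aut}(N)$; that is, every isometry of $N$ preserving the splitting $TN=\mathfrak zN\oplus\mathfrak vN$ is the composition of a left translation and an isometric automorphism of $N$.
   Context: $\mathfrak n$ is the Lie algebra of $N$ with center $\mathfrak z$, $[\mathfrak n,\mathfrak n]\subseteq\mathfrak z$, and inner product (nondegenerate symmetric bilinear form) $\langle\,,\rangle$. Decomposition: $\mathfrak U=\mathfrak z\cap\mathfrak z^\perp$; $\mathfrak V$ is a chosen totally null subspace with $\dim\mathfrak V=\dim\mathfrak U$, dually paired with $\mathfrak U$ by $\langle\,,\rangle$; $\mathfrak Z=\mathfrak z\cap\mathfrak U^\perp\cap\mathfrak V^\perp$; $\mathfrak E$ is the orthogonal complement of $\mathfrak Z$ in $\mathfrak U^\perp\cap\mathfrak V^\perp$. Then $\mathfrak z=\mathfrak U\oplus\mathfrak Z$; put $\mathfrak v=\mathfrak V\oplus\mathfrak E$, so $\mathfrak n=\mathfrak z\oplus\mathfrak v$. $TN=\mathfrak zN\oplus\mathfrak vN$ is the induced splitting of the tangent bundle into left-invariant subbundles. $I(N)$ is the isometry group of $N$; $I^{spl}(N)$ is the subgroup of isometries whose differentials preserve both subbundles $\mathfrak zN$ and $\mathfrak vN$; $O(N)=\operatorname{Aut}(N)\cap I(N)$; $I^{aut}(N)=O(N)\ltimes N$, where $N$ acts by left translations. *)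

theory Defs
  imports "HOL-Analysis.Analysis" "HOL-Algebra.Bij"
begin

section \<open>Smooth maps between Euclidean spaces\<close>

text \<open>Only meant for open \<open>S\<close>.\<close>

primrec Ck_on ::
  "nat \<Rightarrow> 'a::euclidean_space set \<Rightarrow> ('a \<Rightarrow> 'b::euclidean_space) \<Rightarrow> bool" where
  "Ck_on 0 S f \<longleftrightarrow> continuous_on S f"
| "Ck_on (Suc k) S f \<longleftrightarrow>
     (\<forall>x\<in>S. f differentiable (at x)) \<and>
     (\<forall>v. Ck_on k S (\<lambda>x. frechet_derivative f (at x) v))"

definition smooth_on :: "'a::euclidean_space set \<Rightarrow> ('a \<Rightarrow> 'b::euclidean_space) \<Rightarrow> bool" where
  "smooth_on S f \<longleftrightarrow> (\<forall>k. Ck_on k S f)"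


section \<open>Smooth manifolds\<close>

text \<open>
  The manifold is a whole type \<open>'m\<close> (with its topology), modelled on the Euclidean space \<open>'e\<close>.
  A chart is a pair of its domain and its coordinate map; the values of the coordinate map
  outside the domain are irrelevant.
\<close>

type_synonym ('m, 'e) chart = "'m set \<times> ('m \<Rightarrow> 'e)"
type_synonym ('m, 'e) atlas = "('m, 'e) chart set"

definition chart_inv :: "('m, 'e) chart \<Rightarrow> 'e \<Rightarrow> 'm" where
  "chart_inv c = inv_into (fst c) (snd c)"

text \<open>Hausdorffness and second countability are imposed through the sort of \<open>'m\<close>.\<close>

definition smooth_manifold ::
  "('m::{t2_space,second_countable_topology}, 'e::euclidean_space) atlas \<Rightarrow> bool" where
  "smooth_manifold A \<longleftrightarrow>
     (\<Union>c\<in>A. fst c) = UNIV \<and>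
     (\<forall>c\<in>A. open (fst c) \<and> open (snd c ` fst c) \<and>
            homeomorphism (fst c) (snd c ` fst c) (snd c) (chart_inv c)) \<and>
     (\<forall>c\<in>A. \<forall>d\<in>A. smooth_on (snd c ` (fst c \<inter> fst d)) (snd d \<circ> chart_inv c))"

definition smooth_map ::
  "('m::topological_space, 'e::euclidean_space) atlas \<Rightarrow>
   ('n::topological_space, 'f::euclidean_space) atlas \<Rightarrow> ('m \<Rightarrow> 'n) \<Rightarrow> bool" where
  "smooth_map A B f \<longleftrightarrow>
     continuous_on UNIV f \<and>
     (\<forall>c\<in>A. \<forall>d\<in>B. smooth_on (snd c ` (fst c \<inter> f -` fst d)) (snd d \<circ> f \<circ> chart_inv c))"

definition prod_atlas ::
  "('m, 'e) atlas \<Rightarrow> ('n, 'f) atlas \<Rightarrow> ('m \<times> 'n, 'e \<times> 'f) atlas" where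
  "prod_atlas A B = {(fst c \<times> fst d, map_prod (snd c) (snd d)) |c d. c \<in> A \<and> d \<in> B}"

text \<open>
  Tangent spaces: at every point \<open>p\<close> a chart \<open>chart_at A p\<close> around \<open>p\<close> is chosen once and for all,
  and a tangent vector at \<open>p\<close> is represented by its components in this chart. Thus every tangent
  space has the model space \<open>'e\<close> as its underlying vector space, and a vector field is a function
  \<open>'m \<Rightarrow> 'e\<close>; no relation between the charts chosen at different points is implied.
\<close>

definition chart_at :: "('m, 'e) atlas \<Rightarrow> 'm \<Rightarrow> ('m, 'e) chart" where
  "chart_at A p = (SOME c. c \<in> A \<and> p \<in> fst c)"

definition mderiv ::
  "('m, 'e::euclidean_space) atlas \<Rightarrow> ('n, 'f::euclidean_space) atlas \<Rightarrow>
   ('m \<Rightarrow> 'n) \<Rightarrow> 'm \<Rightarrow> 'e \<Rightarrow> 'f" where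
  "mderiv A B f p =
     frechet_derivative (snd (chart_at B (f p)) \<circ> f \<circ> chart_inv (chart_at A p))
       (at (snd (chart_at A p) p))"

text \<open>
  \<open>to_coords A c p\<close> is the differential at \<open>p\<close> of the coordinate map of \<open>c\<close>, a map from the
  tangent space at \<open>p\<close> to \<open>'e\<close>; \<open>from_coords A c p\<close> is the differential of its inverse.
\<close>

definition to_coords ::
  "('m, 'e::euclidean_space) atlas \<Rightarrow> ('m, 'e) chart \<Rightarrow> 'm \<Rightarrow> 'e \<Rightarrow> 'e" where
  "to_coords A c p =
     frechet_derivative (snd c \<circ> chart_inv (chart_at A p)) (at (snd (chart_at A p) p))"

definition from_coords ::
  "('m, 'e::euclidean_space) atlas \<Rightarrow> ('m, 'e) chart \<Rightarrow> 'm \<Rightarrow> 'e \<Rightarrow> 'e" where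
  "from_coords A c p = frechet_derivative (snd (chart_at A p) \<circ> chart_inv c) (at (snd c p))"

definition field_in_chart ::
  "('m, 'e::euclidean_space) atlas \<Rightarrow> ('m, 'e) chart \<Rightarrow> ('m \<Rightarrow> 'e) \<Rightarrow> 'e \<Rightarrow> 'e" where
  "field_in_chart A c X u = to_coords A c (chart_inv c u) (X (chart_inv c u))"

text \<open>The usual bracket \<open>[X, Y] = DY(X) - DX(Y)\<close> in coordinates, computed at \<open>p\<close> in the chart
  chosen at \<open>p\<close>.\<close>

definition vf_bracket ::
  "('m, 'e::euclidean_space) atlas \<Rightarrow> ('m \<Rightarrow> 'e) \<Rightarrow> ('m \<Rightarrow> 'e) \<Rightarrow> 'm \<Rightarrow> 'e" where
  "vf_bracket A X Y p =
     (let c = chart_at A p; u = snd c p; X' = field_in_chart A c X; Y' = field_in_chart A c Y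
      in frechet_derivative Y' (at u) (X' u) - frechet_derivative X' (at u) (Y' u))"


section \<open>Pseudo-Riemannian metrics and isometries\<close>

definition inner_product :: "('e::euclidean_space \<Rightarrow> 'e \<Rightarrow> real) \<Rightarrow> bool" where
  "inner_product b \<longleftrightarrow>
     bilinear b \<and> (\<forall>x y. b x y = b y x) \<and> (\<forall>x. (\<forall>y. b x y = 0) \<longrightarrow> x = 0)"

definition pseudo_riemannian_metric ::
  "('m, 'e::euclidean_space) atlas \<Rightarrow> ('m \<Rightarrow> 'e \<Rightarrow> 'e \<Rightarrow> real) \<Rightarrow> bool" where
  "pseudo_riemannian_metric A g \<longleftrightarrow>
     (\<forall>p. inner_product (g p)) \<and>
     (\<forall>c\<in>A. \<forall>v w. smooth_on (snd c ` fst c)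
        (\<lambda>u. g (chart_inv c u) (from_coords A c (chart_inv c u) v)
                               (from_coords A c (chart_inv c u) w)))"

definition isometries ::
  "('m::topological_space, 'e::euclidean_space) atlas \<Rightarrow> ('m \<Rightarrow> 'e \<Rightarrow> 'e \<Rightarrow> real) \<Rightarrow>
   ('m \<Rightarrow> 'm) set" where
  "isometries A g =
     {f. bij f \<and> smooth_map A A f \<and> smooth_map A A (inv_into UNIV f) \<and>
         (\<forall>p u v. g (f p) (mderiv A A f p u) (mderiv A A f p v) = g p u v)}"

definition isometry_group ::
  "('m::topological_space, 'e::euclidean_space) atlas \<Rightarrow> ('m \<Rightarrow> 'e \<Rightarrow> 'e \<Rightarrow> real) \<Rightarrow>
   ('m \<Rightarrow> 'm) monoid" where
  "isometry_group A g = (BijGroup UNIV)\<lparr>carrier := isometries A g\<rparr>"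


section \<open>Lie groups\<close>

definition lie_group ::
  "'g::{t2_space,second_countable_topology} monoid \<Rightarrow> ('g, 'e::euclidean_space) atlas \<Rightarrow> bool"
  where
  "lie_group N A \<longleftrightarrow>
     group N \<and> carrier N = UNIV \<and> smooth_manifold A \<and>
     smooth_map (prod_atlas A A) A (\<lambda>(x, y). x \<otimes>\<^bsub>N\<^esub> y) \<and>
     smooth_map A A (\<lambda>x. inv\<^bsub>N\<^esub> x)"

definition left_translation :: "'g monoid \<Rightarrow> 'g \<Rightarrow> 'g \<Rightarrow> 'g" where
  "left_translation N a = (\<lambda>x. a \<otimes>\<^bsub>N\<^esub> x)"

text \<open>The Lie algebra is the tangent space \<open>'e\<close> at the identity.\<close>

definition left_invariant_field ::
  "'g monoid \<Rightarrow> ('g, 'e::euclidean_space) atlas \<Rightarrow> 'e \<Rightarrow> 'g \<Rightarrow> 'e" where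
  "left_invariant_field N A x p = mderiv A A (left_translation N p) \<one>\<^bsub>N\<^esub> x"

definition lie_bracket ::
  "'g monoid \<Rightarrow> ('g, 'e::euclidean_space) atlas \<Rightarrow> 'e \<Rightarrow> 'e \<Rightarrow> 'e" where
  "lie_bracket N A x y =
     vf_bracket A (left_invariant_field N A x) (left_invariant_field N A y) \<one>\<^bsub>N\<^esub>"

definition lie_center :: "'g monoid \<Rightarrow> ('g, 'e::euclidean_space) atlas \<Rightarrow> 'e set" where
  "lie_center N A = {x. \<forall>y. lie_bracket N A x y = 0}"

text \<open>Read as \<open>[\<nn>, \<nn>] \<subseteq> \<zz>\<close>, so that abelian groups are included.\<close>

definition two_step_nilpotent :: "'g monoid \<Rightarrow> ('g, 'e::euclidean_space) atlas \<Rightarrow> bool" where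
  "two_step_nilpotent N A \<longleftrightarrow> (\<forall>x y. lie_bracket N A x y \<in> lie_center N A)"

definition left_invariant_metric ::
  "'g monoid \<Rightarrow> ('g, 'e::euclidean_space) atlas \<Rightarrow> ('g \<Rightarrow> 'e \<Rightarrow> 'e \<Rightarrow> real) \<Rightarrow> bool" where
  "left_invariant_metric N A g \<longleftrightarrow>
     (\<forall>a p u v. g (a \<otimes>\<^bsub>N\<^esub> p) (mderiv A A (left_translation N a) p u)
                             (mderiv A A (left_translation N a) p v) = g p u v)"


section \<open>The splitting of the Lie algebra and of the tangent bundle\<close>

definition perp :: "('e \<Rightarrow> 'e \<Rightarrow> real) \<Rightarrow> 'e set \<Rightarrow> 'e set" where
  "perp b S = {x. \<forall>y\<in>S. b x y = 0}"

text \<open>In what follows \<open>b\<close> is the inner product on the Lie algebra and \<open>\<zz>\<close> its center.\<close>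

definition U_space :: "('e \<Rightarrow> 'e \<Rightarrow> real) \<Rightarrow> 'e set \<Rightarrow> 'e set" where
  "U_space b \<zz> = \<zz> \<inter> perp b \<zz>"

definition admissible_V :: "('e::euclidean_space \<Rightarrow> 'e \<Rightarrow> real) \<Rightarrow> 'e set \<Rightarrow> 'e set \<Rightarrow> bool" where
  "admissible_V b \<zz> V \<longleftrightarrow>
     subspace V \<and> (\<forall>x\<in>V. \<forall>y\<in>V. b x y = 0) \<and> dim V = dim (U_space b \<zz>) \<and>
     (\<forall>x\<in>U_space b \<zz>. (\<forall>y\<in>V. b x y = 0) \<longrightarrow> x = 0) \<and>
     (\<forall>y\<in>V. (\<forall>x\<in>U_space b \<zz>. b x y = 0) \<longrightarrow> y = 0)"

definition Z_space :: "('e \<Rightarrow> 'e \<Rightarrow> real) \<Rightarrow> 'e set \<Rightarrow> 'e set \<Rightarrow> 'e set" where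
  "Z_space b \<zz> V = \<zz> \<inter> perp b (U_space b \<zz>) \<inter> perp b V"

definition E_space :: "('e \<Rightarrow> 'e \<Rightarrow> real) \<Rightarrow> 'e set \<Rightarrow> 'e set \<Rightarrow> 'e set" where
  "E_space b \<zz> V = perp b (U_space b \<zz>) \<inter> perp b V \<inter> perp b (Z_space b \<zz> V)"

definition v_space :: "('e::euclidean_space \<Rightarrow> 'e \<Rightarrow> real) \<Rightarrow> 'e set \<Rightarrow> 'e set \<Rightarrow> 'e set" where
  "v_space b \<zz> V = {x + y |x y. x \<in> V \<and> y \<in> E_space b \<zz> V}"

text \<open>The fibre at \<open>p\<close> of the left-invariant subbundle with fibre \<open>S\<close> at the identity.\<close>

definition left_invariant_bundle ::
  "'g monoid \<Rightarrow> ('g, 'e::euclidean_space) atlas \<Rightarrow> 'e set \<Rightarrow> 'g \<Rightarrow> 'e set" where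
  "left_invariant_bundle N A S p = mderiv A A (left_translation N p) \<one>\<^bsub>N\<^esub> ` S"

definition zN :: "'g monoid \<Rightarrow> ('g, 'e::euclidean_space) atlas \<Rightarrow> 'g \<Rightarrow> 'e set" where
  "zN N A = left_invariant_bundle N A (lie_center N A)"

definition vN ::
  "'g monoid \<Rightarrow> ('g, 'e::euclidean_space) atlas \<Rightarrow> ('g \<Rightarrow> 'e \<Rightarrow> 'e \<Rightarrow> real) \<Rightarrow> 'e set \<Rightarrow>
   'g \<Rightarrow> 'e set" where
  "vN N A g V = left_invariant_bundle N A (v_space (g \<one>\<^bsub>N\<^esub>) (lie_center N A) V)"


section \<open>The groups of isometries\<close>

definition I_spl ::
  "'g::topological_space monoid \<Rightarrow> ('g, 'e::euclidean_space) atlas \<Rightarrow>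
   ('g \<Rightarrow> 'e \<Rightarrow> 'e \<Rightarrow> real) \<Rightarrow> 'e set \<Rightarrow> ('g \<Rightarrow> 'g) set" where
  "I_spl N A g V =
     {f \<in> isometries A g.
        \<forall>p. mderiv A A f p ` zN N A p = zN N A (f p) \<and>
            mderiv A A f p ` vN N A g V p = vN N A g V (f p)}"

definition O_group ::
  "'g::topological_space monoid \<Rightarrow> ('g, 'e::euclidean_space) atlas \<Rightarrow>
   ('g \<Rightarrow> 'e \<Rightarrow> 'e \<Rightarrow> real) \<Rightarrow> ('g \<Rightarrow> 'g) set" where
  "O_group N A g = auto N \<inter> isometries A g"

text \<open>The inner semidirect product of \<open>O_group N A g\<close> with the group of left translations.\<close>

definition I_aut ::
  "'g::topological_space monoid \<Rightarrow> ('g, 'e::euclidean_space) atlas \<Rightarrow>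
   ('g \<Rightarrow> 'e \<Rightarrow> 'e \<Rightarrow> real) \<Rightarrow> ('g \<Rightarrow> 'g) set" where
  "I_aut N A g = {left_translation N a \<circ> \<phi> |a \<phi>. a \<in> carrier N \<and> \<phi> \<in> O_group N A g}"

end

theory Submission
  imports Defs
begin

text \<open>
  Write an isometry \<open>f\<close> in the left trivialization: \<open>\<phi>(q)\<close> is the differential of
  \<open>x \<mapsto> f(q)\<^sup>-\<^sup>1 f(q x)\<close> at the identity. Pulling back the Maurer-Cartan equation along \<open>f\<close> gives, at
  every point, \<open>\<phi>[x, y] - [\<phi> x, \<phi> y] = \<alpha>(x, y) - \<alpha>(y, x)\<close>, where \<open>\<alpha>(x, y)\<close> is the derivative of
  \<open>\<phi> y\<close> along the left-invariant field \<open>x\<close>. If \<open>f\<close> preserves the splitting, then for \<open>x, y\<close> in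
  \<open>\<vv>\<close> the left side lies in \<open>\<zz>\<close> and the right side in \<open>\<vv>\<close>, so both vanish; for central \<open>x\<close> the
  left side vanishes anyway. Hence \<open>\<alpha>\<close> is symmetric. As \<open>\<phi>\<close> is isometric, \<open>\<phi>\<^sup>-\<^sup>1 \<alpha>(x, _)\<close> is skew,
  so \<open>\<alpha> = 0\<close> by the argument that proves uniqueness of the Levi-Civita connection. Thus \<open>\<phi>\<close> is
  constant; then \<open>x \<mapsto> f(a x) f(x)\<^sup>-\<^sup>1\<close> has zero differential, which gives
  \<open>f(a x) = f(a) f(1)\<^sup>-\<^sup>1 f(x)\<close>.
\<close>

section \<open>Differential calculus of smooth maps\<close>

text \<open>The chart that represents the tangent space varies arbitrarily with the point, so
  differentials at neighbouring points cannot be compared as they stand. Left translation carries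
  them all to the identity, where the single chart \<open>c0\<close> serves. Replacing
  \<open>f\<close> by \<open>left_diff f q\<close>, which fixes the identity and whose left
  derivative at \<open>x\<close> is that of \<open>f\<close> at \<open>q \<otimes> x\<close>,
  reduces every infinitesimal claim at \<open>q\<close> to one at the identity. The splitting enters
  through \<phi> alone, which maps the fixed subspaces \<zz> and \<vv> onto themselves: brackets and
  their images under \<phi> are therefore central, while the derivative of a vector moving inside
  \<vv> stays in \<vv>. For central x the vector \<phi> x is central too, which is why both brackets
  vanish. The metric may be indefinite, so no norm estimate is available. Nondegeneracy suffices: it
  makes the isometric \<phi> injective, hence onto, so pairing \<alpha> with all \<phi> w detects
  every nonzero value of \<alpha>.\<close>

lemma Ck_on_subset: "Ck_on k S f \<Longrightarrow> T \<subseteq> S \<Longrightarrow> Ck_on k T f"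
  by (induction k arbitrary: f) (auto intro: continuous_on_subset)

lemma Ck_on_cong:
  assumes "open S" "\<And>x. x \<in> S \<Longrightarrow> f x = g x" "Ck_on k S f"
  shows "Ck_on k S g"
  using assms(2,3)
proof (induction k arbitrary: f g)
  case 0
  then show ?case by (simp cong: continuous_on_cong)
next
  case (Suc k)
  have d: "(g has_derivative frechet_derivative f (at x)) (at x)" if "x \<in> S" for x
    using has_derivative_transform_within_open[of f _ x UNIV S g] \<open>open S\<close> that Suc.prems
    by (auto simp: frechet_derivative_works)
  have "Ck_on k S (\<lambda>x. frechet_derivative g (at x) v)" for v
  proof (rule Suc.IH[of "\<lambda>x. frechet_derivative f (at x) v"])
    show "frechet_derivative f (at x) v = frechet_derivative g (at x) v" if "x \<in> S" for x
      using frechet_derivative_at[OF d[OF that]] by simp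
  qed (use Suc.prems in auto)
  with d show ?case by (auto simp: differentiable_def)
qed

lemma Ck_on_local:
  assumes "\<And>x. x \<in> S \<Longrightarrow> \<exists>T. open T \<and> x \<in> T \<and> Ck_on k T f"
  shows "Ck_on k S f"
  using assms
proof (induction k arbitrary: f)
  case 0
  then show ?case
    by (auto intro!: continuous_at_imp_continuous_on simp: continuous_on_eq_continuous_at) 
      (metis continuous_on_eq_continuous_at)
next
  case (Suc k)
  have "f differentiable (at x)" if "x \<in> S" for x
    using Suc.prems[OF that] by auto
  moreover have "Ck_on k S (\<lambda>x. frechet_derivative f (at x) v)" for v
    by (rule Suc.IH) (use Suc.prems in fastforce)
  ultimately show ?case by auto
qed

lemma Ck_on_Suc_D: "Ck_on (Suc k) S f \<Longrightarrow> Ck_on k S f"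
proof (induction k arbitrary: f)
  case 0
  then show ?case
    by (auto intro!: continuous_at_imp_continuous_on differentiable_imp_continuous_within)
next
  case (Suc k)
  then show ?case by (metis Ck_on.simps(2))
qed

lemma Ck_on_const: "Ck_on k S (\<lambda>x. c)"
  by (induction k arbitrary: c) (auto simp: frechet_derivative_const)

text \<open>\<open>frechet_derivative\<close> is a choice operator and awkward to compute. Here any
  explicit derivative formula may take its place, so each closure property below is one derivative
  rule and an induction on \<open>k\<close>.\<close>

lemma Ck_on_SucI:
  assumes "open S" "\<And>x. x \<in> S \<Longrightarrow> (f has_derivative f' x) (at x)"
    "\<And>v. Ck_on k S (\<lambda>x. f' x v)"
  shows "Ck_on (Suc k) S f"
proof -
  have "Ck_on k S (\<lambda>x. frechet_derivative f (at x) v)" for v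
    by (rule Ck_on_cong[OF assms(1) _ assms(3)[of v]]) (simp add: frechet_derivative_at[OF assms(2), symmetric])
  with assms(2) show ?thesis by (auto simp: differentiable_def)
qed

lemma Ck_on_Suc_has_derivative:
  "Ck_on (Suc k) S f \<Longrightarrow> x \<in> S \<Longrightarrow> (f has_derivative frechet_derivative f (at x)) (at x)"
  by (simp add: frechet_derivative_works)

lemma Ck_on_bounded_linear_compose:
  assumes "open S" "bounded_linear h" "Ck_on k S f"
  shows "Ck_on k S (\<lambda>x. h (f x))"
  using assms(3)
proof (induction k arbitrary: f)
  case 0
  then show ?case using assms(2)
    by (auto intro: bounded_linear.continuous_on)
next
  case (Suc k)
  show ?case
    by (rule Ck_on_SucI[OF assms(1) bounded_linear.has_derivative[OF assms(2) Ck_on_Suc_has_derivative[OF Suc.prems]]])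
      (use Suc in auto)
qed

lemma Ck_on_id: "open S \<Longrightarrow> Ck_on k S (\<lambda>x. x)"
  by (cases k) (simp_all add: Ck_on_const)

lemma Ck_on_bounded_linear: "open S \<Longrightarrow> bounded_linear h \<Longrightarrow> Ck_on k S h"
  using Ck_on_bounded_linear_compose[OF _ _ Ck_on_id] by blast

lemma Ck_on_add:
  assumes "open S" "Ck_on k S f" "Ck_on k S g"
  shows "Ck_on k S (\<lambda>x. f x + g x)"
  using assms(2,3)
proof (induction k arbitrary: f g)
  case 0
  then show ?case by (auto intro: continuous_intros)
next
  case (Suc k)
  show ?case
    by (rule Ck_on_SucI[OF assms(1) has_derivative_add[OF Ck_on_Suc_has_derivative[OF Suc.prems(1)] Ck_on_Suc_has_derivative[OF Suc.prems(2)]]])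
      (use Suc in auto)
qed

lemma Ck_on_sum:
  assumes "open S" "\<And>i. i \<in> I \<Longrightarrow> Ck_on k S (f i)"
  shows "Ck_on k S (\<lambda>x. \<Sum>i\<in>I. f i x)"
  using assms(2)
  by (induction I rule: infinite_finite_induct) (auto simp: Ck_on_const intro: Ck_on_add[OF assms(1)])

lemma Ck_on_scaleR:
  assumes "open S" "Ck_on k S f" "Ck_on k S g"
  shows "Ck_on k S (\<lambda>x. f x *\<^sub>R g x)"
  using assms(2,3)
proof (induction k arbitrary: f g)
  case 0
  then show ?case by (auto intro: continuous_intros)
next
  case (Suc k)
  show ?case
  proof (rule Ck_on_SucI[OF assms(1) has_derivative_scaleR[OF Ck_on_Suc_has_derivative[OF Suc.prems(1)] Ck_on_Suc_has_derivative[OF Suc.prems(2)]]])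
    fix v
    have "Ck_on k S f" "Ck_on k S g" "Ck_on k S (\<lambda>x. frechet_derivative f (at x) v)"
      "Ck_on k S (\<lambda>x. frechet_derivative g (at x) v)"
      using Suc.prems Ck_on_Suc_D by auto
    then show "Ck_on k S (\<lambda>x. f x *\<^sub>R frechet_derivative g (at x) v + frechet_derivative f (at x) v *\<^sub>R g x)"
      by (intro Ck_on_add[OF assms(1)] Suc.IH)
  qed
qed

lemma linear_euclidean_expansion:
  fixes h :: "'a::euclidean_space \<Rightarrow> 'b::real_vector"
  assumes "linear h"
  shows "h x = (\<Sum>i\<in>Basis. (x \<bullet> i) *\<^sub>R h i)"
  using linear_sum[OF assms, of "\<lambda>i. (x \<bullet> i) *\<^sub>R i" Basis] 
  by (simp add: euclidean_representation linear_cmul[OF assms])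

text \<open>In the chain rule both the linear map g' (f x) and its argument f' x v vary with x,
  whereas \<open>Ck_on\<close> speaks of derivatives in fixed directions only. Expanding the
  argument in \<open>Basis\<close> turns the expression into a finite sum of products, to which the
  induction hypothesis applies with a partial derivative of \<open>g\<close> in the role of
  \<open>g\<close>.\<close>

lemma Ck_on_compose:
  assumes "open S" "open T" "Ck_on k S f" "Ck_on k T g" "f ` S \<subseteq> T"
  shows "Ck_on k S (\<lambda>x. g (f x))"
  using assms(3-5)
proof (induction k arbitrary: f g)
  case 0
  then show ?case by (auto intro: continuous_on_compose2)
next
  case (Suc k)
  let ?f' = "\<lambda>x. frechet_derivative f (at x)" and ?g' = "\<lambda>y. frechet_derivative g (at y)"
  have d: "((\<lambda>x. g (f x)) has_derivative (\<lambda>v. ?g' (f x) (?f' x v))) (at x)" if "x \<in> S" for x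
    using that Suc.prems
    by (intro has_derivative_compose[OF Ck_on_Suc_has_derivative Ck_on_Suc_has_derivative]) auto
  have lin: "linear (?g' (f x))" if "x \<in> S" for x
    using that Suc.prems by (auto intro!: linear_frechet_derivative simp: image_subset_iff)
  show ?case
  proof (rule Ck_on_SucI[OF assms(1) d], assumption)
    fix v
    have "Ck_on k S (\<lambda>x. \<Sum>i\<in>Basis. (?f' x v \<bullet> i) *\<^sub>R ?g' (f x) i)"
    proof (intro Ck_on_sum Ck_on_scaleR assms(1))
      fix i :: 'b
      show "Ck_on k S (\<lambda>x. ?f' x v \<bullet> i)"
        by (rule Ck_on_bounded_linear_compose[OF assms(1) bounded_linear_inner_left]) (use Suc.prems in auto)
      show "Ck_on k S (\<lambda>x. ?g' (f x) i)"
        using Suc.IH[of f "\<lambda>y. ?g' y i"] Ck_on_Suc_D[OF Suc.prems(1)] Suc.prems(2,3) by simp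
    qed
    then show "Ck_on k S (\<lambda>x. ?g' (f x) (?f' x v))"
      by (rule Ck_on_cong[OF assms(1), rotated]) (simp add: linear_euclidean_expansion[OF lin, symmetric])
  qed
qed

lemma Ck_on_Pair:
  assumes "open S" "Ck_on k S f" "Ck_on k S g"
  shows "Ck_on k S (\<lambda>x. (f x, g x))"
proof -
  have "bounded_linear (\<lambda>y. (y, 0))" "bounded_linear (\<lambda>y. (0, y))"
    by (auto intro!: bounded_linear_Pair bounded_linear_ident bounded_linear_zero)
  then have "Ck_on k S (\<lambda>x. (f x, 0) + (0, g x))"
    by (intro Ck_on_add Ck_on_bounded_linear_compose[of S "\<lambda>y. (y, 0)"] 
       Ck_on_bounded_linear_compose[of S "\<lambda>y. (0, y)"] assms)
  then show ?thesis by simp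
qed

lemma smooth_on_subset: "smooth_on S f \<Longrightarrow> T \<subseteq> S \<Longrightarrow> smooth_on T f"
  unfolding smooth_on_def using Ck_on_subset by blast

lemma smooth_on_cong:
  "open S \<Longrightarrow> smooth_on S f \<Longrightarrow> (\<And>x. x \<in> S \<Longrightarrow> f x = g x) \<Longrightarrow> smooth_on S g"
  unfolding smooth_on_def using Ck_on_cong by blast

lemma smooth_on_local:
  assumes "\<And>x. x \<in> S \<Longrightarrow> \<exists>T. open T \<and> x \<in> T \<and> smooth_on T f"
  shows "smooth_on S f"
  unfolding smooth_on_def
proof (intro allI Ck_on_local)
  show "\<exists>T. open T \<and> x \<in> T \<and> Ck_on k T f" if "x \<in> S" for x k
    using assms[OF that] unfolding smooth_on_def by blast
qed

lemma smooth_on_compose: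
  "open S \<Longrightarrow> open T \<Longrightarrow> smooth_on S f \<Longrightarrow> smooth_on T g \<Longrightarrow> f ` S \<subseteq> T \<Longrightarrow> smooth_on S (\<lambda>x. g (f x))"
  unfolding smooth_on_def using Ck_on_compose by blast

lemma smooth_on_Pair:
  "open S \<Longrightarrow> smooth_on S f \<Longrightarrow> smooth_on S g \<Longrightarrow> smooth_on S (\<lambda>x. (f x, g x))"
  unfolding smooth_on_def using Ck_on_Pair by blast

lemma smooth_on_const: "smooth_on S (\<lambda>x. c)"
  unfolding smooth_on_def using Ck_on_const by blast

lemma smooth_on_bounded_linear: "open S \<Longrightarrow> bounded_linear h \<Longrightarrow> smooth_on S h"
  unfolding smooth_on_def using Ck_on_bounded_linear by blast

lemma smooth_on_frechet_derivative:
  "smooth_on S f \<Longrightarrow> smooth_on S (\<lambda>x. frechet_derivative f (at x) v)"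
  unfolding smooth_on_def by (metis Ck_on.simps(2))

lemma smooth_on_has_derivative:
  "smooth_on S f \<Longrightarrow> x \<in> S \<Longrightarrow> (f has_derivative frechet_derivative f (at x)) (at x)"
  unfolding smooth_on_def by (metis Ck_on_Suc_has_derivative)

section \<open>Symmetry of second derivatives\<close>

lemma second_difference_mvt:
  fixes f :: "'a::real_normed_vector \<Rightarrow> real"
  assumes "t > 0"
    and D: "\<And>s r. s \<in> {0..t} \<Longrightarrow> r \<in> {0..t} \<Longrightarrow>
      (f has_derivative f' (a + s *\<^sub>R x + r *\<^sub>R y)) (at (a + s *\<^sub>R x + r *\<^sub>R y))"
    and D2: "\<And>s r. s \<in> {0..t} \<Longrightarrow> r \<in> {0..t} \<Longrightarrow>
      ((\<lambda>p. f' p x) has_derivative h (a + s *\<^sub>R x + r *\<^sub>R y)) (at (a + s *\<^sub>R x + r *\<^sub>R y))"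
  shows "\<exists>s\<in>{0..t}. \<exists>r\<in>{0..t}. f (a + t *\<^sub>R x + t *\<^sub>R y) - f (a + t *\<^sub>R x) - f (a + t *\<^sub>R y) + f a
    = t * t * h (a + s *\<^sub>R x + r *\<^sub>R y) y"
proof -
  have d1: "((\<lambda>s. f (a + s *\<^sub>R x + r *\<^sub>R y)) has_real_derivative f' (a + s *\<^sub>R x + r *\<^sub>R y) x) (at s)"
    if "s \<in> {0..t}" "r \<in> {0..t}" for s r
  proof -
    have lin: "linear (f' (a + s *\<^sub>R x + r *\<^sub>R y))"
      using D[OF that] has_derivative_linear by blast
    have "((\<lambda>s. f (a + s *\<^sub>R x + r *\<^sub>R y)) has_derivative (\<lambda>u. f' (a + s *\<^sub>R x + r *\<^sub>R y) (u *\<^sub>R x))) (at s)"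
      by (rule has_derivative_compose[where g = "f" and f = "\<lambda>s. a + s *\<^sub>R x + r *\<^sub>R y"
            and g' = "f' (a + s *\<^sub>R x + r *\<^sub>R y)", OF _ D[OF that]])
        (auto intro!: derivative_eq_intros)
    then show ?thesis
      by (simp add: has_field_derivative_def linear_cmul[OF lin] mult_commute_abs)
  qed
  have d2: "((\<lambda>r. f' (a + s *\<^sub>R x + r *\<^sub>R y) x) has_real_derivative h (a + s *\<^sub>R x + r *\<^sub>R y) y) (at r)"
    if "s \<in> {0..t}" "r \<in> {0..t}" for s r
  proof -
    have lin: "linear (h (a + s *\<^sub>R x + r *\<^sub>R y))"
      using D2[OF that] has_derivative_linear by blast
    have "((\<lambda>r. f' (a + s *\<^sub>R x + r *\<^sub>R y) x) has_derivative (\<lambda>u. h (a + s *\<^sub>R x + r *\<^sub>R y) (u *\<^sub>R y))) (at r)"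
      by (rule has_derivative_compose[where g = "\<lambda>p. f' p x" and f = "\<lambda>r. a + s *\<^sub>R x + r *\<^sub>R y"
            and g' = "h (a + s *\<^sub>R x + r *\<^sub>R y)", OF _ D2[OF that]])
        (auto intro!: derivative_eq_intros)
    then show ?thesis
      by (simp add: has_field_derivative_def linear_cmul[OF lin] mult_commute_abs)
  qed
  \<comment> \<open>The second difference is the increment over [0, t] of s \<mapsto> f (a + s x + t
    y) - f (a + s x). The mean value theorem turns it into a difference of first derivatives along
    y, and a second use of the theorem in the y direction produces \<open>h\<close>.\<close>
  have "\<exists>s. s > 0 \<and> s < t \<and>
      (f (a + t *\<^sub>R x + t *\<^sub>R y) - f (a + t *\<^sub>R x + 0 *\<^sub>R y)) - (f (a + 0 *\<^sub>R x + t *\<^sub>R y) - f (a + 0 *\<^sub>R x + 0 *\<^sub>R y))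
      = (t - 0) * (f' (a + s *\<^sub>R x + t *\<^sub>R y) x - f' (a + s *\<^sub>R x + 0 *\<^sub>R y) x)"
    by (rule MVT2[OF assms(1)], rule DERIV_diff; rule d1) (use assms(1) in auto)
  then obtain s where s0: "s > 0" "s < t"
      "(f (a + t *\<^sub>R x + t *\<^sub>R y) - f (a + t *\<^sub>R x + 0 *\<^sub>R y)) - (f (a + 0 *\<^sub>R x + t *\<^sub>R y) - f (a + 0 *\<^sub>R x + 0 *\<^sub>R y))
      = (t - 0) * (f' (a + s *\<^sub>R x + t *\<^sub>R y) x - f' (a + s *\<^sub>R x + 0 *\<^sub>R y) x)"
    by blast
  then have s: "s \<in> {0..t}"
    "f (a + t *\<^sub>R x + t *\<^sub>R y) - f (a + t *\<^sub>R x) - f (a + t *\<^sub>R y) + f a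
      = t * (f' (a + s *\<^sub>R x + t *\<^sub>R y) x - f' (a + s *\<^sub>R x + 0 *\<^sub>R y) x)"
    by simp_all
  have "\<exists>r. r > 0 \<and> r < t \<and> f' (a + s *\<^sub>R x + t *\<^sub>R y) x - f' (a + s *\<^sub>R x + 0 *\<^sub>R y) x
      = (t - 0) * h (a + s *\<^sub>R x + r *\<^sub>R y) y"
    by (rule MVT2[OF assms(1)], rule d2) (use s in auto)
  then obtain r where "r > 0" "r < t" "f' (a + s *\<^sub>R x + t *\<^sub>R y) x - f' (a + s *\<^sub>R x + 0 *\<^sub>R y) x
      = (t - 0) * h (a + s *\<^sub>R x + r *\<^sub>R y) y" by blast
  then have "r \<in> {0..t}" "f' (a + s *\<^sub>R x + t *\<^sub>R y) x - f' (a + s *\<^sub>R x + 0 *\<^sub>R y) x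
      = t * h (a + s *\<^sub>R x + r *\<^sub>R y) y" by simp_all
  with s show ?thesis by (intro bexI[of _ s] bexI[of _ r]) auto
qed

text \<open>The second difference over a parallelogram does not change when x and y are exchanged,
  and in either order it is t * t times a mixed derivative at some point of the parallelogram.
  Shrinking the parallelogram, continuity forces the two mixed derivatives at \<open>a\<close> to
  agree.\<close>

lemma symmetric_second_derivative_real:
  fixes f :: "'a::euclidean_space \<Rightarrow> real"
  assumes "open S" "a \<in> S" "Ck_on 2 S f"
  shows "frechet_derivative (\<lambda>p. frechet_derivative f (at p) x) (at a) y
       = frechet_derivative (\<lambda>p. frechet_derivative f (at p) y) (at a) x"
proof -
  define f' where "f' p = frechet_derivative f (at p)" for p
  define h where "h v p w = frechet_derivative (\<lambda>p. f' p v) (at p) w" for v p w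
  have C: "\<forall>x\<in>S. f differentiable at x" "\<forall>v. \<forall>x\<in>S. (\<lambda>p. f' p v) differentiable at x"
    "\<And>v w. continuous_on S (\<lambda>p. h v p w)"
    using assms(3) by (auto simp: numeral_2_eq_2 f'_def h_def)
  have f': "(f has_derivative f' p) (at p)" if "p \<in> S" for p
    using C(1) that by (auto simp: f'_def frechet_derivative_works)
  have h: "((\<lambda>p. f' p v) has_derivative h v p) (at p)" if "p \<in> S" for p v
  proof -
    have "h v p = frechet_derivative (\<lambda>p. f' p v) (at p)" by (simp add: h_def fun_eq_iff)
    then show ?thesis using C(2) that by (auto simp: frechet_derivative_works)
  qed
  have "h x a y - h y a x = 0"
  proof (rule ccontr)
    assume ne: "h x a y - h y a x \<noteq> 0"
    \<comment> \<open>Half the gap: the balls of radius \<open>e\<close> around the two distinct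
      values are disjoint, so equal numbers cannot lie one in each.\<close>
    define e where "e = \<bar>h x a y - h y a x\<bar> / 2"
    have "e > 0" using ne by (simp add: e_def)
    have "\<exists>d>0. \<forall>p. dist p a < d \<longrightarrow> p \<in> S \<and> dist (h v p w) (h v a w) < e" for v w
    proof -
      have "\<forall>\<^sub>F p in nhds a. p \<in> S \<and> dist (h v p w) (h v a w) < e"
      proof (rule eventually_conj)
        show "\<forall>\<^sub>F p in nhds a. p \<in> S" using assms(1,2) by (rule eventually_nhds_in_open)
        have "isCont (\<lambda>p. h v p w) a" using C(3) assms by (simp add: continuous_on_eq_continuous_at)
        then show "\<forall>\<^sub>F p in nhds a. dist (h v p w) (h v a w) < e"
          using tendsto_at_iff_tendsto_nhds[of "\<lambda>p. h v p w" a] tendstoD[OF _ \<open>e > 0\<close>]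
          by (simp add: isCont_def)
      qed
      then show ?thesis by (simp add: eventually_nhds_metric)
    qed
    then obtain d1 d2 where d: "d1 > 0" "d2 > 0"
      "\<And>p. dist p a < d1 \<Longrightarrow> p \<in> S \<and> dist (h x p y) (h x a y) < e"
      "\<And>p. dist p a < d2 \<Longrightarrow> p \<in> S \<and> dist (h y p x) (h y a x) < e" by metis
    \<comment> \<open>Small enough to keep the whole parallelogram strictly within distance min d1
      d2 of \<open>a\<close>; the summand 1 keeps the denominator positive when x and y are
      zero.\<close>
    define t where "t = min d1 d2 / (norm x + norm y + 1)"
    have t: "t > 0" using d by (auto simp: t_def intro!: divide_pos_pos add_nonneg_pos)
    have near: "dist (a + s *\<^sub>R x + r *\<^sub>R y) a < min d1 d2" if "s \<in> {0..t}" "r \<in> {0..t}" for s r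
    proof -
      have "dist (a + s *\<^sub>R x + r *\<^sub>R y) a \<le> s * norm x + r * norm y"
        using that norm_triangle_ineq[of "s *\<^sub>R x" "r *\<^sub>R y"] by (simp add: dist_norm add.assoc)
      also have "\<dots> \<le> t * norm x + t * norm y"
        using that by (intro add_mono mult_right_mono) auto
      also have "\<dots> < t * (norm x + norm y + 1)" using t by (simp add: algebra_simps)
      also have "\<dots> = min d1 d2"
      proof -
        have "norm x + norm y + 1 > 0" by (simp add: add_nonneg_pos)
        then show ?thesis by (simp add: t_def)
      qed
      finally show ?thesis .
    qed
    have near2: "dist (a + r *\<^sub>R y + s *\<^sub>R x) a < min d1 d2" if "s \<in> {0..t}" "r \<in> {0..t}" for s r
      using near[OF that] by (simp add: algebra_simps)
    have inS: "a + s *\<^sub>R x + r *\<^sub>R y \<in> S" "a + r *\<^sub>R y + s *\<^sub>R x \<in> S" if "s \<in> {0..t}" "r \<in> {0..t}" for s r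
      using near[OF that] near2[OF that] d(3) by auto
    obtain s r where sr: "s \<in> {0..t}" "r \<in> {0..t}"
      "f (a + t *\<^sub>R x + t *\<^sub>R y) - f (a + t *\<^sub>R x) - f (a + t *\<^sub>R y) + f a = t * t * h x (a + s *\<^sub>R x + r *\<^sub>R y) y"
      using second_difference_mvt[where f = f and f' = f' and h = "h x" and a = a and x = x and y = y,
          OF t f'[OF inS(1)] h[OF inS(1)]] by blast
    obtain s' r' where sr': "s' \<in> {0..t}" "r' \<in> {0..t}"
      "f (a + t *\<^sub>R y + t *\<^sub>R x) - f (a + t *\<^sub>R y) - f (a + t *\<^sub>R x) + f a = t * t * h y (a + s' *\<^sub>R y + r' *\<^sub>R x) x"
      using second_difference_mvt[where f = f and f' = f' and h = "h y" and a = a and x = y and y = x,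
          OF t f'[OF inS(2)] h[OF inS(2)]] by blast
    have e: "a + t *\<^sub>R y + t *\<^sub>R x = a + t *\<^sub>R x + t *\<^sub>R y" by simp
    have "t * t * h x (a + s *\<^sub>R x + r *\<^sub>R y) y = t * t * h y (a + s' *\<^sub>R y + r' *\<^sub>R x) x"
      using sr(3) sr'(3)[unfolded e] by linarith
    then have "h x (a + s *\<^sub>R x + r *\<^sub>R y) y = h y (a + s' *\<^sub>R y + r' *\<^sub>R x) x" using t by simp
    moreover have "dist (h x (a + s *\<^sub>R x + r *\<^sub>R y) y) (h x a y) < e"
      using near[OF sr(1,2)] d(3) by simp
    moreover have "dist (h y (a + s' *\<^sub>R y + r' *\<^sub>R x) x) (h y a x) < e"
      using near2[OF sr'(2,1)] d(4) by simp
    moreover have aux: "p = q \<Longrightarrow> \<bar>p - u\<bar> < \<bar>u - v\<bar> / 2 \<Longrightarrow> \<bar>q - v\<bar> < \<bar>u - v\<bar> / 2 \<Longrightarrow> False"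
      for p q u v :: real by (auto simp: abs_if split: if_splits)
    ultimately show False
      using aux unfolding e_def dist_real_def by blast
  qed
  then show ?thesis by (simp add: h_def f'_def)
qed

lemma symmetric_second_derivative:
  fixes f :: "'a::euclidean_space \<Rightarrow> 'b::euclidean_space"
  assumes S: "open S" "a \<in> S" and f: "smooth_on S f"
  shows "frechet_derivative (\<lambda>p. frechet_derivative f (at p) x) (at a) y
       = frechet_derivative (\<lambda>p. frechet_derivative f (at p) y) (at a) x"
proof (rule euclidean_eqI)
  fix i :: 'b
  note bl = bounded_linear_inner_left[of i]
  have f1: "frechet_derivative (\<lambda>p. f p \<bullet> i) (at p) v = frechet_derivative f (at p) v \<bullet> i" if "p \<in> S" for p v
    using frechet_derivative_at[OF bounded_linear.has_derivative[OF bl smooth_on_has_derivative[OF f that]]] by metis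
  have f2: "frechet_derivative (\<lambda>p. frechet_derivative (\<lambda>p. f p \<bullet> i) (at p) v) (at a) w
     = frechet_derivative (\<lambda>p. frechet_derivative f (at p) v) (at a) w \<bullet> i" for v w
  proof -
    have "((\<lambda>p. frechet_derivative f (at p) v \<bullet> i) has_derivative
        (\<lambda>w. frechet_derivative (\<lambda>p. frechet_derivative f (at p) v) (at a) w \<bullet> i)) (at a)"
      by (intro bounded_linear.has_derivative[OF bl] smooth_on_has_derivative[OF smooth_on_frechet_derivative[OF f]] S)
    then have "((\<lambda>p. frechet_derivative (\<lambda>p. f p \<bullet> i) (at p) v) has_derivative
        (\<lambda>w. frechet_derivative (\<lambda>p. frechet_derivative f (at p) v) (at a) w \<bullet> i)) (at a)"
      by (rule has_derivative_transform_within_open[OF _ S]) (simp add: f1)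
    from frechet_derivative_at[OF this] show ?thesis by metis
  qed
  have "Ck_on 2 S (\<lambda>p. f p \<bullet> i)"
    using f S(1) bl by (auto simp: smooth_on_def intro: Ck_on_bounded_linear_compose[OF S(1) bl])
  from symmetric_second_derivative_real[OF S this]
  show "frechet_derivative (\<lambda>p. frechet_derivative f (at p) x) (at a) y \<bullet> i
       = frechet_derivative (\<lambda>p. frechet_derivative f (at p) y) (at a) x \<bullet> i"
    by (simp add: f2)
qed

section \<open>Smooth maps of manifolds\<close>

lemma chart_inv_in: "u \<in> snd c ` fst c \<Longrightarrow> chart_inv c u \<in> fst c"
  unfolding chart_inv_def by (rule inv_into_into)

lemma chart_inv_right: "u \<in> snd c ` fst c \<Longrightarrow> snd c (chart_inv c u) = u"
  unfolding chart_inv_def by (rule f_inv_into_f)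

lemma chart_inv_left: "smooth_manifold A \<Longrightarrow> c \<in> A \<Longrightarrow> p \<in> fst c \<Longrightarrow> chart_inv c (snd c p) = p"
  unfolding smooth_manifold_def homeomorphism_def by blast

lemma chart_inj_on: "smooth_manifold A \<Longrightarrow> c \<in> A \<Longrightarrow> inj_on (snd c) (fst c)"
  by (rule inj_on_inverseI[of _ "chart_inv c"]) (rule chart_inv_left)

lemma chart_open: "smooth_manifold A \<Longrightarrow> c \<in> A \<Longrightarrow> open (fst c)"
  unfolding smooth_manifold_def by blast

lemma chart_continuous:
  assumes "smooth_manifold A" "c \<in> A"
  shows "continuous_on (fst c) (snd c)" "continuous_on (snd c ` fst c) (chart_inv c)"
  using assms unfolding smooth_manifold_def homeomorphism_def by blast+

lemma chart_image_open:
  assumes "smooth_manifold A" "c \<in> A" "open T"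
  shows "open (snd c ` (fst c \<inter> T))"
proof -
  have "open (chart_inv c -` T \<inter> snd c ` fst c)"
    using assms chart_continuous(2)[OF assms(1,2)] continuous_on_open_vimage
    unfolding smooth_manifold_def by blast
  moreover have "chart_inv c -` T \<inter> snd c ` fst c = snd c ` (fst c \<inter> T)"
    using chart_inv_left[OF assms(1,2)] by force
  ultimately show ?thesis by simp
qed

lemma chart_at:
  assumes "smooth_manifold A"
  shows "chart_at A p \<in> A" "p \<in> fst (chart_at A p)"
proof -
  have "\<exists>c. c \<in> A \<and> p \<in> fst c"
    using assms unfolding smooth_manifold_def by blast
  from someI_ex[OF this] show "chart_at A p \<in> A" "p \<in> fst (chart_at A p)"
    unfolding chart_at_def by auto
qed

lemma smooth_map_continuous: "smooth_map A B f \<Longrightarrow> continuous_on UNIV f"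
  by (simp add: smooth_map_def)

lemma smooth_map_on_charts:
  "smooth_map A B f \<Longrightarrow> c \<in> A \<Longrightarrow> d \<in> B \<Longrightarrow>
    smooth_on (snd c ` (fst c \<inter> f -` fst d)) (\<lambda>u. snd d (f (chart_inv c u)))"
  unfolding smooth_map_def comp_def by blast

lemma smooth_map_domain_open:
  assumes "smooth_manifold A" "smooth_manifold B" "smooth_map A B f" "c \<in> A" "d \<in> B"
  shows "open (snd c ` (fst c \<inter> f -` fst d))"
  by (rule chart_image_open[OF assms(1,4)])
    (intro open_vimage chart_open[OF assms(2,5)] smooth_map_continuous[OF assms(3)])

lemma smooth_map_id: "smooth_manifold A \<Longrightarrow> smooth_map A A (\<lambda>x. x)"
  unfolding smooth_map_def smooth_manifold_def comp_def by simp

lemma smooth_map_const: "smooth_map A B (\<lambda>x. b)"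
  unfolding smooth_map_def by (simp add: comp_def smooth_on_const)

text \<open>The image under \<open>f\<close> of a chart domain need not lie in one chart of
  \<open>B\<close>, so smoothness is checked near each point, through a chart of \<open>B\<close>
  around the image of that point.\<close>

lemma smooth_map_compose:
  assumes M: "smooth_manifold A" "smooth_manifold B" "smooth_manifold C"
    and f: "smooth_map A B f" and g: "smooth_map B C g"
  shows "smooth_map A C (\<lambda>x. g (f x))"
  unfolding smooth_map_def comp_def
proof (intro conjI ballI)
  show "continuous_on UNIV (\<lambda>x. g (f x))"
    by (rule continuous_on_compose2[OF smooth_map_continuous[OF g] smooth_map_continuous[OF f]]) auto
next
  fix c e assume c: "c \<in> A" and e: "e \<in> C"
  show "smooth_on (snd c ` (fst c \<inter> (\<lambda>x. g (f x)) -` fst e)) (\<lambda>u. snd e (g (f (chart_inv c u))))"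
  proof (rule smooth_on_local)
    fix u assume "u \<in> snd c ` (fst c \<inter> (\<lambda>x. g (f x)) -` fst e)"
    then obtain p where p: "p \<in> fst c" "g (f p) \<in> fst e" "u = snd c p" by auto
    define d where "d = chart_at B (f p)"
    have d: "d \<in> B" "f p \<in> fst d" using chart_at[OF M(2)] by (auto simp: d_def)
    let ?W = "fst d \<inter> g -` fst e"
    let ?T = "snd c ` (fst c \<inter> f -` ?W)"
    have oW: "open ?W"
      by (intro open_Int open_vimage chart_open[OF M(2) d(1)] chart_open[OF M(3) e] smooth_map_continuous[OF g])
    have oT: "open ?T"
      by (intro chart_image_open[OF M(1) c] open_vimage oW smooth_map_continuous[OF f])
    have "smooth_on ?T (\<lambda>u. (\<lambda>w. snd e (g (chart_inv d w))) (snd d (f (chart_inv c u))))"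
    proof (rule smooth_on_compose[OF oT smooth_map_domain_open[OF M(2,3) g d(1) e]])
      show "smooth_on ?T (\<lambda>u. snd d (f (chart_inv c u)))"
        by (rule smooth_on_subset[OF smooth_map_on_charts[OF f c d(1)]]) auto
      show "smooth_on (snd d ` (fst d \<inter> g -` fst e)) (\<lambda>w. snd e (g (chart_inv d w)))"
        by (rule smooth_map_on_charts[OF g d(1) e])
      show "(\<lambda>u. snd d (f (chart_inv c u))) ` ?T \<subseteq> snd d ` (fst d \<inter> g -` fst e)"
        using chart_inv_left[OF M(1) c] by auto
    qed
    then have "smooth_on ?T (\<lambda>u. snd e (g (f (chart_inv c u))))"
      by (rule smooth_on_cong[OF oT]) (auto simp: chart_inv_left[OF M(1) c] chart_inv_left[OF M(2) d(1)])
    moreover have "u \<in> ?T" using p d by auto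
    ultimately show "\<exists>T. open T \<and> u \<in> T \<and> smooth_on T (\<lambda>u. snd e (g (f (chart_inv c u))))"
      using oT by blast
  qed
qed

section \<open>Product manifolds\<close>

lemma map_prod_image_Times: "map_prod f g ` (S \<times> T) = f ` S \<times> g ` T"
  by auto

text \<open>\<open>chart_inv\<close> is an \<open>inv_into\<close>, so its values are pinned down by
  injectivity only on the image of the chart domain. This is why the uses below pass through
  \<open>smooth_on_cong\<close> on an open subset of that image.\<close>

lemma chart_inv_prod:
  assumes M: "smooth_manifold A" "smooth_manifold B" "c \<in> A" "d \<in> B"
    and z: "z \<in> (snd c ` fst c) \<times> (snd d ` fst d)"
  shows "chart_inv (fst c \<times> fst d, map_prod (snd c) (snd d)) z = (chart_inv c (fst z), chart_inv d (snd z))"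
proof -
  have "inj_on (map_prod (snd c) (snd d)) (fst c \<times> fst d)"
    using chart_inj_on[OF M(1,3)] chart_inj_on[OF M(2,4)] by (rule map_prod_inj_on)
  moreover have "map_prod (snd c) (snd d) (chart_inv c (fst z), chart_inv d (snd z)) = z"
    using z by (auto simp: chart_inv_right)
  moreover have "(chart_inv c (fst z), chart_inv d (snd z)) \<in> fst c \<times> fst d"
    using z by (auto simp: chart_inv_in)
  ultimately show ?thesis
    unfolding chart_inv_def[of "(fst c \<times> fst d, _)"] fst_conv snd_conv by (intro inv_into_f_eq)
qed

lemma smooth_on_fst_snd:
  assumes "open S" "open T"
  shows "smooth_on S f \<Longrightarrow> smooth_on (S \<times> T) (\<lambda>z. f (fst z))"
    "smooth_on T h \<Longrightarrow> smooth_on (S \<times> T) (\<lambda>z. h (snd z))"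
proof -
  have o: "open (S \<times> T)" using assms by (rule open_Times)
  show "smooth_on S f \<Longrightarrow> smooth_on (S \<times> T) (\<lambda>z. f (fst z))"
    by (rule smooth_on_compose[OF o assms(1) smooth_on_bounded_linear[OF o bounded_linear_fst]]) auto
  show "smooth_on T h \<Longrightarrow> smooth_on (S \<times> T) (\<lambda>z. h (snd z))"
    by (rule smooth_on_compose[OF o assms(2) smooth_on_bounded_linear[OF o bounded_linear_snd]]) auto
qed

lemma smooth_manifold_prod:
  assumes M: "smooth_manifold A" "smooth_manifold B"
  shows "smooth_manifold (prod_atlas A B)"
  unfolding smooth_manifold_def
proof (intro conjI ballI)
  show "(\<Union>c\<in>prod_atlas A B. fst c) = UNIV"
  proof -
    have "\<exists>k\<in>prod_atlas A B. p \<in> fst k" for p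
    proof
      let ?c = "chart_at A (fst p)" and ?d = "chart_at B (snd p)"
      show "(fst ?c \<times> fst ?d, map_prod (snd ?c) (snd ?d)) \<in> prod_atlas A B"
        unfolding prod_atlas_def using chart_at(1)[OF M(1)] chart_at(1)[OF M(2)] by blast
      show "p \<in> fst (fst ?c \<times> fst ?d, map_prod (snd ?c) (snd ?d))"
        using chart_at(2)[OF M(1)] chart_at(2)[OF M(2)] by (simp add: mem_Times_iff)
    qed
    then show ?thesis by blast
  qed
next
  fix k assume "k \<in> prod_atlas A B"
  then obtain c d where k: "k = (fst c \<times> fst d, map_prod (snd c) (snd d))" "c \<in> A" "d \<in> B"
    unfolding prod_atlas_def by auto
  have im: "snd k ` fst k = snd c ` fst c \<times> snd d ` fst d"
    by (simp add: k map_prod_image_Times)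
  show "open (fst k)" using k by (auto intro!: open_Times chart_open M)
  show "open (snd k ` fst k)" unfolding im
    using chart_image_open[OF M(1) k(2) open_UNIV] chart_image_open[OF M(2) k(3) open_UNIV]
    by (auto intro!: open_Times)
  have inv: "chart_inv k z = (chart_inv c (fst z), chart_inv d (snd z))" if "z \<in> snd k ` fst k" for z
    by (rule chart_inv_prod[OF M k(2,3), folded k(1)]) (use that im in simp)
  show "homeomorphism (fst k) (snd k ` fst k) (snd k) (chart_inv k)"
  proof (rule homeomorphismI)
    have "continuous_on (fst c \<times> fst d) (\<lambda>z. (snd c (fst z), snd d (snd z)))"
      by (rule continuous_on_Pair;
        rule continuous_on_compose2[OF chart_continuous(1)[OF M(1) k(2)] continuous_on_fst[OF continuous_on_id]]
          continuous_on_compose2[OF chart_continuous(1)[OF M(2) k(3)] continuous_on_snd[OF continuous_on_id]]; force)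
    then show "continuous_on (fst k) (snd k)"
      by (simp add: k(1) map_prod_def case_prod_beta)
    have "continuous_on (snd c ` fst c \<times> snd d ` fst d) (\<lambda>z. (chart_inv c (fst z), chart_inv d (snd z)))"
      by (rule continuous_on_Pair;
        rule continuous_on_compose2[OF chart_continuous(2)[OF M(1) k(2)] continuous_on_fst[OF continuous_on_id]]
          continuous_on_compose2[OF chart_continuous(2)[OF M(2) k(3)] continuous_on_snd[OF continuous_on_id]]; force)
    then show "continuous_on (snd k ` fst k) (chart_inv k)"
      unfolding im[symmetric] by (rule continuous_on_eq) (simp add: inv)
    show "chart_inv k (snd k p) = p" if "p \<in> fst k" for p
      using that inv[of "snd k p"] chart_inv_left[OF M(1) k(2)] chart_inv_left[OF M(2) k(3)]
      by (auto simp: k(1))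
  qed (auto simp: chart_inv_in chart_inv_right)
next
  fix k k' assume "k \<in> prod_atlas A B" "k' \<in> prod_atlas A B"
  then obtain c d c' d' where k: "k = (fst c \<times> fst d, map_prod (snd c) (snd d))" "c \<in> A" "d \<in> B"
    and k': "k' = (fst c' \<times> fst d', map_prod (snd c') (snd d'))" "c' \<in> A" "d' \<in> B"
    unfolding prod_atlas_def by auto
  let ?S = "snd c ` (fst c \<inter> fst c')" and ?T = "snd d ` (fst d \<inter> fst d')"
  have im: "snd k ` (fst k \<inter> fst k') = ?S \<times> ?T"
    by (simp add: k k' Times_Int_Times map_prod_image_Times)
  have o: "open ?S" "open ?T"
    using chart_image_open[OF M(1) k(2) chart_open[OF M(1) k'(2)]]
      chart_image_open[OF M(2) k(3) chart_open[OF M(2) k'(3)]] by auto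
  have "smooth_on ?S (snd c' \<circ> chart_inv c)" "smooth_on ?T (snd d' \<circ> chart_inv d)"
    using M k k' unfolding smooth_manifold_def by blast+
  then have "smooth_on (?S \<times> ?T) (\<lambda>z. ((snd c' \<circ> chart_inv c) (fst z), (snd d' \<circ> chart_inv d) (snd z)))"
    by (intro smooth_on_Pair smooth_on_fst_snd o open_Times)
  then show "smooth_on (snd k ` (fst k \<inter> fst k')) (snd k' \<circ> chart_inv k)"
    unfolding im
  proof (rule smooth_on_cong[rotated])
    fix z assume "z \<in> ?S \<times> ?T"
    then have "z \<in> snd c ` fst c \<times> snd d ` fst d" by auto
    from chart_inv_prod[OF M k(2,3) this]
    show "((snd c' \<circ> chart_inv c) (fst z), (snd d' \<circ> chart_inv d) (snd z)) = (snd k' \<circ> chart_inv k) z"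
      by (simp add: k(1) k'(1))
  qed (intro o open_Times)
qed

lemma smooth_map_fst_snd:
  assumes M: "smooth_manifold A" "smooth_manifold B"
  shows "smooth_map (prod_atlas A B) A fst" "smooth_map (prod_atlas A B) B snd"
proof -
  show "smooth_map (prod_atlas A B) A fst"
    unfolding smooth_map_def
  proof (intro conjI ballI)
    fix k e assume "k \<in> prod_atlas A B" and e: "e \<in> A"
    then obtain c d where k: "k = (fst c \<times> fst d, map_prod (snd c) (snd d))" "c \<in> A" "d \<in> B"
      unfolding prod_atlas_def by auto
    let ?S = "snd c ` (fst c \<inter> fst e)" and ?T = "snd d ` (fst d \<inter> UNIV)"
    have im: "snd k ` (fst k \<inter> fst -` fst e) = ?S \<times> ?T"
      by (force simp: k)
    have o: "open ?S" "open ?T"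
      using chart_image_open[OF M(1) k(2) chart_open[OF M(1) e]] chart_image_open[OF M(2) k(3) open_UNIV] by auto
    have "smooth_on ?S (snd e \<circ> chart_inv c)"
      using M k e unfolding smooth_manifold_def by blast
    then have "smooth_on (?S \<times> ?T) (\<lambda>z. (snd e \<circ> chart_inv c) (fst z))"
      by (intro smooth_on_fst_snd o open_Times)
    then show "smooth_on (snd k ` (fst k \<inter> fst -` fst e)) (snd e \<circ> fst \<circ> chart_inv k)"
      unfolding im
    proof (rule smooth_on_cong[rotated])
      fix z assume "z \<in> ?S \<times> ?T"
      then have "z \<in> snd c ` fst c \<times> snd d ` fst d" by auto
      from chart_inv_prod[OF M k(2,3) this]
      show "(snd e \<circ> chart_inv c) (fst z) = (snd e \<circ> fst \<circ> chart_inv k) z"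
        by (simp add: k(1))
    qed (intro o open_Times)
  qed (intro continuous_intros)
  show "smooth_map (prod_atlas A B) B snd"
    unfolding smooth_map_def
  proof (intro conjI ballI)
    fix k e assume "k \<in> prod_atlas A B" and e: "e \<in> B"
    then obtain c d where k: "k = (fst c \<times> fst d, map_prod (snd c) (snd d))" "c \<in> A" "d \<in> B"
      unfolding prod_atlas_def by auto
    let ?S = "snd c ` (fst c \<inter> UNIV)" and ?T = "snd d ` (fst d \<inter> fst e)"
    have im: "snd k ` (fst k \<inter> snd -` fst e) = ?S \<times> ?T"
      by (force simp: k)
    have o: "open ?S" "open ?T"
      using chart_image_open[OF M(2) k(3) chart_open[OF M(2) e]] chart_image_open[OF M(1) k(2) open_UNIV] by auto
    have "smooth_on ?T (snd e \<circ> chart_inv d)"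
      using M k e unfolding smooth_manifold_def by blast
    then have "smooth_on (?S \<times> ?T) (\<lambda>z. (snd e \<circ> chart_inv d) (snd z))"
      by (intro smooth_on_fst_snd o open_Times)
    then show "smooth_on (snd k ` (fst k \<inter> snd -` fst e)) (snd e \<circ> snd \<circ> chart_inv k)"
      unfolding im
    proof (rule smooth_on_cong[rotated])
      fix z assume "z \<in> ?S \<times> ?T"
      then have "z \<in> snd c ` fst c \<times> snd d ` fst d" by auto
      from chart_inv_prod[OF M k(2,3) this]
      show "(snd e \<circ> chart_inv d) (snd z) = (snd e \<circ> snd \<circ> chart_inv k) z"
        by (simp add: k(1))
    qed (intro o open_Times)
  qed (intro continuous_intros)
qed

lemma smooth_map_Pair:
  assumes M: "smooth_manifold A" "smooth_manifold B" "smooth_manifold C"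
    and f: "smooth_map A B f" and g: "smooth_map A C g"
  shows "smooth_map A (prod_atlas B C) (\<lambda>x. (f x, g x))"
  unfolding smooth_map_def
proof (intro conjI ballI)
  show "continuous_on UNIV (\<lambda>x. (f x, g x))"
    using smooth_map_continuous[OF f] smooth_map_continuous[OF g] by (rule continuous_on_Pair)
next
  fix c k assume c: "c \<in> A" and "k \<in> prod_atlas B C"
  then obtain d e where k: "k = (fst d \<times> fst e, map_prod (snd d) (snd e))" "d \<in> B" "e \<in> C"
    unfolding prod_atlas_def by auto
  let ?S = "snd c ` (fst c \<inter> (f -` fst d \<inter> g -` fst e))"
  have o: "open ?S"
    by (intro chart_image_open[OF M(1) c] open_Int open_vimage smooth_map_continuous[OF f] smooth_map_continuous[OF g]
      chart_open[OF M(2) k(2)] chart_open[OF M(3) k(3)])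
  have "smooth_on ?S (\<lambda>u. (snd d (f (chart_inv c u)), snd e (g (chart_inv c u))))"
    by (intro smooth_on_Pair o smooth_on_subset[OF smooth_map_on_charts[OF f c k(2)]]
       smooth_on_subset[OF smooth_map_on_charts[OF g c k(3)]]) auto
  moreover have "snd c ` (fst c \<inter> (\<lambda>x. (f x, g x)) -` fst k) = ?S"
    by (auto simp: k)
  ultimately show "smooth_on (snd c ` (fst c \<inter> (\<lambda>x. (f x, g x)) -` fst k)) (snd k \<circ> (\<lambda>x. (f x, g x)) \<circ> chart_inv c)"
    by (simp add: k(1) comp_def)
qed

text \<open>Unlike \<open>mderiv\<close>, which is tied to \<open>chart_at\<close> at each single
  point, this leaves both charts free. They can then stay fixed while the point moves, which is what
  differentiating or comparing differentials requires.\<close>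

definition chart_deriv ::
  "('m, 'e::euclidean_space) chart \<Rightarrow> ('n, 'f::euclidean_space) chart \<Rightarrow> ('m \<Rightarrow> 'n) \<Rightarrow> 'm \<Rightarrow> 'e \<Rightarrow> 'f" where
  "chart_deriv c d f p = frechet_derivative (\<lambda>u. snd d (f (chart_inv c u))) (at (snd c p))"

lemma mderiv_chart_deriv: "mderiv A B f p = chart_deriv (chart_at A p) (chart_at B (f p)) f p"
  by (simp add: mderiv_def chart_deriv_def comp_def)

lemma to_coords_chart_deriv: "to_coords A c p = chart_deriv (chart_at A p) c (\<lambda>x. x) p"
  by (simp add: to_coords_def chart_deriv_def comp_def)

lemma chart_deriv_works:
  assumes "smooth_map A B f" "c \<in> A" "d \<in> B" "p \<in> fst c" "f p \<in> fst d"
  shows "((\<lambda>u. snd d (f (chart_inv c u))) has_derivative chart_deriv c d f p) (at (snd c p))"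
  unfolding chart_deriv_def
  using smooth_map_on_charts[OF assms(1-3)] by (rule smooth_on_has_derivative) (use assms in auto)

lemma linear_chart_deriv:
  assumes "smooth_map A B f" "c \<in> A" "d \<in> B" "p \<in> fst c" "f p \<in> fst d"
  shows "linear (chart_deriv c d f p)"
  using chart_deriv_works[OF assms] has_derivative_linear by blast

lemma chart_deriv_compose:
  assumes M: "smooth_manifold A" "smooth_manifold B"
    and f: "smooth_map A B f" and g: "smooth_map B C g"
    and c: "c \<in> A" "p \<in> fst c" and d: "d \<in> B" "f p \<in> fst d" and e: "e \<in> C" "g (f p) \<in> fst e"
  shows "chart_deriv c e (\<lambda>x. g (f x)) p v = chart_deriv d e g (f p) (chart_deriv c d f p v)"
proof -
  let ?F = "\<lambda>u. snd d (f (chart_inv c u))" and ?G = "\<lambda>w. snd e (g (chart_inv d w))"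
  have F: "(?F has_derivative chart_deriv c d f p) (at (snd c p))"
    by (rule chart_deriv_works[OF f c(1) d(1) c(2) d(2)])
  have "?F (snd c p) = snd d (f p)" using chart_inv_left[OF M(1) c] by simp
  then have G: "(?G has_derivative chart_deriv d e g (f p)) (at (?F (snd c p)))"
    using chart_deriv_works[OF g d(1) e(1) d(2) e(2)] by simp
  have "((\<lambda>u. ?G (?F u)) has_derivative (\<lambda>v. chart_deriv d e g (f p) (chart_deriv c d f p v))) (at (snd c p))"
    by (rule has_derivative_compose[OF F G])
  then have "((\<lambda>u. snd e (g (f (chart_inv c u)))) has_derivative
      (\<lambda>v. chart_deriv d e g (f p) (chart_deriv c d f p v))) (at (snd c p))"
  proof (rule has_derivative_transform_within_open)
    show "open (snd c ` (fst c \<inter> f -` fst d))"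
      by (rule smooth_map_domain_open[OF M f c(1) d(1)])
  qed (use c d in \<open>auto simp: chart_inv_left[OF M(1) c(1)] chart_inv_left[OF M(2) d(1)]\<close>)
  from frechet_derivative_at[OF this] show ?thesis
    unfolding chart_deriv_def by metis
qed

lemma chart_deriv_id:
  assumes M: "smooth_manifold A" and c: "c \<in> A" "p \<in> fst c"
  shows "chart_deriv c c (\<lambda>x. x) p v = v"
proof -
  have "((\<lambda>u. snd c (chart_inv c u)) has_derivative (\<lambda>v. v)) (at (snd c p))"
    by (rule has_derivative_transform_within_open[OF has_derivative_ident chart_image_open[OF M c(1) open_UNIV]])
      (use c in \<open>auto simp: chart_inv_right chart_inv_left[OF M c(1)]\<close>)
  from frechet_derivative_at[OF this] show ?thesis
    unfolding chart_deriv_def by metis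
qed

lemma mderiv_compose:
  assumes M: "smooth_manifold A" "smooth_manifold B" "smooth_manifold C"
    and f: "smooth_map A B f" and g: "smooth_map B C g"
  shows "mderiv A C (\<lambda>x. g (f x)) p v = mderiv B C g (f p) (mderiv A B f p v)"
  unfolding mderiv_chart_deriv by (rule chart_deriv_compose[OF M(1,2) f g]) (intro chart_at M)+

lemma mderiv_id: "smooth_manifold A \<Longrightarrow> mderiv A A (\<lambda>x. x) p v = v"
  unfolding mderiv_chart_deriv by (rule chart_deriv_id) (auto intro: chart_at)

lemma linear_mderiv:
  assumes "smooth_manifold A" "smooth_manifold B" "smooth_map A B f"
  shows "linear (mderiv A B f p)"
  unfolding mderiv_chart_deriv
  by (rule linear_chart_deriv[OF assms(3)]) (intro chart_at assms)+

section \<open>The splitting of the Lie algebra\<close>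

lemma inner_product_linear:
  assumes "inner_product b"
  shows "linear (b x)" "linear (\<lambda>x. b x y)"
  using assms unfolding inner_product_def bilinear_def by auto

lemma inner_product_simps:
  assumes "inner_product b"
  shows "b (x + x') y = b x y + b x' y" "b (x - x') y = b x y - b x' y" "b x (y + y') = b x y + b x y'"
    "b x (y - y') = b x y - b x y'" "b 0 y = 0" "b x 0 = 0" "b (c *\<^sub>R x) y = c * b x y"
    "b x (c *\<^sub>R y) = c * b x y"
  using assms unfolding inner_product_def
  by (auto simp: bilinear_ladd bilinear_lsub bilinear_radd bilinear_rsub bilinear_lzero bilinear_rzero
    bilinear_lmul bilinear_rmul)

lemma inner_product_sym: "inner_product b \<Longrightarrow> b x y = b y x"
  unfolding inner_product_def by blast

lemma subspace_perp: "inner_product b \<Longrightarrow> subspace (perp b S)"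
  by (auto simp: subspace_def perp_def inner_product_simps)

lemma pairing_represents:
  fixes b :: "'e::euclidean_space \<Rightarrow> 'e \<Rightarrow> real"
  assumes b: "inner_product b" and P: "subspace P" and Q: "subspace Q" and dim: "dim P = dim Q"
    and nondeg: "\<And>x. x \<in> P \<Longrightarrow> (\<And>y. y \<in> Q \<Longrightarrow> b x y = 0) \<Longrightarrow> x = 0"
  obtains x where "x \<in> P" "\<And>y. y \<in> Q \<Longrightarrow> b x y = b w y"
proof -
  obtain B where B: "B \<subseteq> Q" "pairwise orthogonal B" "\<And>x. x \<in> B \<Longrightarrow> norm x = 1"
    "independent B" "span B = Q"
    using orthonormal_basis_subspace[OF Q] by metis
  have fin: "finite B" using B(4) by (rule independent_imp_finite)
  define T where "T x = (\<Sum>e\<in>B. b x e *\<^sub>R e)" for x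
  have T_inner: "T x \<bullet> e = b x e" if "e \<in> B" for x e
  proof -
    have "T x \<bullet> e = (\<Sum>e'\<in>B. if e' = e then b x e else 0)"
      unfolding T_def inner_sum_left
      by (rule sum.cong) (use B(2,3) that in \<open>auto simp: pairwise_def orthogonal_def norm_eq_1\<close>)
    then show ?thesis using fin that by simp
  qed
  have T_eq: "b x y = b x' y" if "T x = T x'" "y \<in> Q" for x x' y
    using linear_eq_on[OF inner_product_linear(1)[OF b, of x] inner_product_linear(1)[OF b, of x'], of y B]
      that T_inner B(5) by metis
  have lin: "linear T"
    by (rule linearI) (simp_all add: T_def inner_product_simps[OF b] scaleR_add_left sum.distrib scaleR_sum_right)
  have "inj_on T (span P)"
    unfolding linear_inj_on_iff_eq_0[OF lin subspace_span]
  proof (intro ballI impI)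
    fix x assume x: "x \<in> span P" "T x = 0"
    have "T 0 = 0" using lin by (rule linear_0)
    show "x = 0"
    proof (rule nondeg)
      show "x \<in> P" using x P by (simp add: span_eq_iff[THEN iffD2])
      show "b x y = 0" if "y \<in> Q" for y
        using T_eq[of x 0, OF _ that] x \<open>T 0 = 0\<close> inner_product_simps[OF b] by simp
    qed
  qed
  then have "dim (T ` P) = dim P" by (rule dim_image_eq[OF lin])
  moreover have "T ` UNIV \<subseteq> Q"
    unfolding T_def using B(1) by (auto intro!: subspace_sum[OF Q] subspace_scale[OF Q])
  ultimately have "T ` P = Q"
    by (intro subspace_dim_equal linear_subspace_image lin P Q) (auto simp: dim)
  moreover have "T w \<in> Q" using \<open>T ` UNIV \<subseteq> Q\<close> by blast
  ultimately obtain x where "x \<in> P" "T x = T w" by (metis imageE)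
  with T_eq that show thesis by blast
qed

context
  fixes b :: "'e::euclidean_space \<Rightarrow> 'e \<Rightarrow> real" and \<zz> V :: "'e set"
  assumes b: "inner_product b" and z: "subspace \<zz>" and V: "admissible_V b \<zz> V"
begin

lemma subspace_U: "subspace (U_space b \<zz>)"
  unfolding U_space_def by (intro subspace_inter z subspace_perp b)

lemma subspace_Z: "subspace (Z_space b \<zz> V)"
  unfolding Z_space_def by (intro subspace_inter z subspace_perp b)

lemma subspace_E: "subspace (E_space b \<zz> V)"
  unfolding E_space_def by (intro subspace_inter subspace_perp b)

lemma subspace_V: "subspace V"
  using V by (simp add: admissible_V_def)

lemma subspace_v: "subspace (v_space b \<zz> V)"
  using subspace_sums[OF subspace_V subspace_E] unfolding v_space_def .

lemma U_represents:
  obtains u where "u \<in> U_space b \<zz>" "\<And>y. y \<in> V \<Longrightarrow> b u y = b w y"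
  using pairing_represents[OF b subspace_U subspace_V] V unfolding admissible_V_def by metis

lemma V_represents:
  obtains v where "v \<in> V" "\<And>y. y \<in> U_space b \<zz> \<Longrightarrow> b v y = b w y"
  using pairing_represents[OF b subspace_V subspace_U] V inner_product_sym[OF b]
  unfolding admissible_V_def by metis

text \<open>Modulo \<open>U_space\<close>, every central vector lies in \<open>Z_space\<close>. A
  vector of \<open>Z_space\<close> is orthogonal to \<open>U_space\<close>, so if it is also
  orthogonal to \<open>Z_space\<close> it is orthogonal to the whole center. It then lies in
  \<open>U_space\<close> and is killed by V, which the duality of the two spaces excludes unless it
  is zero.\<close>

lemma Z_nondegenerate:
  assumes x: "x \<in> Z_space b \<zz> V" and orth: "\<And>y. y \<in> Z_space b \<zz> V \<Longrightarrow> b x y = 0"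
  shows "x = 0"
proof -
  have xz: "x \<in> \<zz>" and xU: "\<And>y. y \<in> U_space b \<zz> \<Longrightarrow> b x y = 0" and xV: "\<And>y. y \<in> V \<Longrightarrow> b x y = 0"
    using x by (auto simp: Z_space_def perp_def)
  have "b x w = 0" if w: "w \<in> \<zz>" for w
  proof -
    obtain u where u: "u \<in> U_space b \<zz>" "\<And>y. y \<in> V \<Longrightarrow> b u y = b w y"
      using U_represents[of w] by blast
    have uz: "u \<in> \<zz>" "\<And>y. y \<in> \<zz> \<Longrightarrow> b u y = 0" using u(1) by (auto simp: U_space_def perp_def)
    \<comment> \<open>The vector \<open>u\<close> removes the pairing of \<open>w\<close> with V.
      Orthogonality to \<open>U_space\<close> is automatic, since \<open>w\<close> and
      \<open>u\<close> are both central.\<close>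
    have "w - u \<in> Z_space b \<zz> V"
      unfolding Z_space_def perp_def
    proof (intro IntI CollectI ballI)
      show "w - u \<in> \<zz>" using w uz z by (simp add: subspace_diff)
      show "b (w - u) y = 0" if "y \<in> U_space b \<zz>" for y
        using that w uz inner_product_sym[OF b] by (auto simp: inner_product_simps[OF b] U_space_def perp_def)
      show "b (w - u) y = 0" if "y \<in> V" for y
        using u(2)[OF that] by (simp add: inner_product_simps[OF b])
    qed
    then have "b x (w - u) = 0" by (rule orth)
    then show ?thesis using xU[OF u(1)] by (simp add: inner_product_simps[OF b])
  qed
  then have "x \<in> U_space b \<zz>" using xz by (auto simp: U_space_def perp_def)
  with xV V show ?thesis unfolding admissible_V_def by blast
qed

text \<open>Write x = v + e. Pairing with \<open>U_space\<close> sees only v, because e is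
  orthogonal to it; as x is central this pairing vanishes and duality gives v = 0. What remains lies
  in \<open>Z_space\<close> and is orthogonal to \<open>Z_space\<close>.\<close>

lemma z_Int_v:
  assumes "x \<in> \<zz>" "x \<in> v_space b \<zz> V"
  shows "x = 0"
proof -
  obtain v e where ve: "x = v + e" "v \<in> V" "e \<in> E_space b \<zz> V"
    using assms(2) by (auto simp: v_space_def)
  have "b u v = 0" if u: "u \<in> U_space b \<zz>" for u
  proof -
    have "b u x = 0" using u assms(1) by (auto simp: U_space_def perp_def)
    moreover have "b e u = 0" using u ve(3) by (auto simp: E_space_def perp_def)
    ultimately show ?thesis using ve(1) inner_product_sym[OF b, of e u] by (simp add: inner_product_simps[OF b])
  qed
  then have "v = 0" using V ve(2) unfolding admissible_V_def by blast
  then have e: "x = e" using ve by simp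
  then have "x \<in> Z_space b \<zz> V" using assms(1) ve(3) by (auto simp: E_space_def Z_space_def)
  then show ?thesis using Z_nondegenerate ve(3) e by (auto simp: E_space_def perp_def)
qed

text \<open>Three corrections leave a remainder in \<open>E_space\<close>: v in V removes the
  pairing with \<open>U_space\<close>, u in \<open>U_space\<close> the pairing with V, and s in
  \<open>Z_space\<close> the pairing with \<open>Z_space\<close>. A later correction does not undo
  an earlier one, since u is orthogonal to \<open>U_space\<close> and s to both
  \<open>U_space\<close> and V.\<close>

lemma z_plus_v:
  obtains x y where "x \<in> \<zz>" "y \<in> v_space b \<zz> V" "w = x + y"
proof -
  obtain v where v: "v \<in> V" "\<And>y. y \<in> U_space b \<zz> \<Longrightarrow> b v y = b w y" using V_represents[of w] by blast
  obtain u where u: "u \<in> U_space b \<zz>" "\<And>y. y \<in> V \<Longrightarrow> b u y = b (w - v) y"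
    using U_represents[of "w - v"] by blast
  define w' where "w' = w - v - u"
  obtain s where s: "s \<in> Z_space b \<zz> V" "\<And>y. y \<in> Z_space b \<zz> V \<Longrightarrow> b s y = b w' y"
    using pairing_represents[OF b subspace_Z subspace_Z refl Z_nondegenerate] by metis
  have "w' - s \<in> E_space b \<zz> V"
    unfolding E_space_def perp_def
  proof (intro IntI CollectI ballI)
    fix y assume y: "y \<in> U_space b \<zz>"
    have "b u y = 0" using y u(1) by (auto simp: U_space_def perp_def)
    moreover have "b s y = 0" using y s(1) by (auto simp: Z_space_def perp_def)
    ultimately show "b (w' - s) y = 0" using v(2)[OF y] by (simp add: w'_def inner_product_simps[OF b])
  next
    fix y assume y: "y \<in> V"
    have "b s y = 0" using y s(1) by (auto simp: Z_space_def perp_def)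
    then show "b (w' - s) y = 0" using u(2)[OF y] by (simp add: w'_def inner_product_simps[OF b])
  next
    fix y assume y: "y \<in> Z_space b \<zz> V"
    show "b (w' - s) y = 0" using s(2)[OF y] by (simp add: inner_product_simps[OF b])
  qed
  then have "v + (w' - s) \<in> v_space b \<zz> V" using v(1) by (auto simp: v_space_def)
  moreover have "u + s \<in> \<zz>"
    using u(1) s(1) by (auto simp: U_space_def Z_space_def intro: subspace_add[OF z])
  moreover have "w = (u + s) + (v + (w' - s))" by (simp add: w'_def)
  ultimately show thesis using that by blast
qed

end

text \<open>The uniqueness argument for the Levi-Civita connection.\<close>

lemma symmetric_skew_zero:
  fixes t :: "'a \<Rightarrow> 'a \<Rightarrow> 'a \<Rightarrow> real"
  assumes "\<And>x y w. t x y w = t y x w" "\<And>x y w. t x y w = - t x w y"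
  shows "t x y w = 0"
  using assms by (smt (verit))

text \<open>Let t be the component of f' x orthogonal to S. The function f u \<bullet> t vanishes
  near a, so its derivative f' x \<bullet> t, which equals t \<bullet> t, is zero.\<close>

lemma has_derivative_in_subspace:
  fixes f :: "'a::real_normed_vector \<Rightarrow> 'b::euclidean_space"
  assumes f: "(f has_derivative f') (at a)" and S: "subspace S" and X: "open X" "a \<in> X"
    and fS: "\<And>u. u \<in> X \<Longrightarrow> f u \<in> S"
  shows "f' x \<in> S"
proof -
  obtain s t where st: "s \<in> span S" "\<And>w. w \<in> span S \<Longrightarrow> orthogonal t w" "f' x = s + t"
    using orthogonal_subspace_decomp_exists by metis
  have "((\<lambda>u. f u \<bullet> t) has_derivative (\<lambda>x. f' x \<bullet> t)) (at a)"
    by (rule bounded_linear.has_derivative[OF bounded_linear_inner_left f])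
  moreover have "((\<lambda>u. f u \<bullet> t) has_derivative (\<lambda>x. 0)) (at a)"
    by (rule has_derivative_transform_within_open[OF has_derivative_const[of 0] X])
      (metis fS st(2) span_base orthogonal_def inner_commute)
  ultimately have "(\<lambda>x. f' x \<bullet> t) = (\<lambda>x. 0)" by (rule has_derivative_unique)
  then have "f' x \<bullet> t = 0" by metis
  moreover have "s \<bullet> t = 0" using st(2)[OF st(1)] by (simp add: orthogonal_def inner_commute)
  ultimately have "t = 0" using st(3) by (simp add: inner_add_left)
  then show ?thesis using st S by (simp add: span_eq_iff[THEN iffD2])
qed

lemma linear_parameter_derivative:
  assumes X: "open X" "a \<in> X" and lin: "\<And>u. u \<in> X \<Longrightarrow> linear (T u)"
    and T: "\<And>y. ((\<lambda>u. T u y) has_derivative T' y) (at a)"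
  shows "linear (\<lambda>y. T' y x)"
proof (rule linearI)
  fix y z and c :: real
  have "((\<lambda>u. T u y + T u z) has_derivative T' (y + z)) (at a)"
    by (rule has_derivative_transform_within_open[OF T X]) (simp add: lin linear_add)
  moreover have "((\<lambda>u. T u y + T u z) has_derivative (\<lambda>x. T' y x + T' z x)) (at a)"
    by (intro has_derivative_add T)
  ultimately show "T' (y + z) x = T' y x + T' z x"
    using has_derivative_unique by metis
  have "((\<lambda>u. c *\<^sub>R T u y) has_derivative T' (c *\<^sub>R y)) (at a)"
    by (rule has_derivative_transform_within_open[OF T X]) (simp add: lin linear_cmul)
  moreover have "((\<lambda>u. c *\<^sub>R T u y) has_derivative (\<lambda>x. c *\<^sub>R T' y x)) (at a)"
    by (intro has_derivative_scaleR_right T)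
  ultimately show "T' (c *\<^sub>R y) x = c *\<^sub>R T' y x"
    using has_derivative_unique by metis
qed

text \<open>A product rule for a moving linear map applied to a moving vector. The derivative of
  \<open>T\<close> is known on fixed vectors only, so \<open>h u\<close> is expanded in
  \<open>Basis\<close> before differentiating.\<close>

lemma has_derivative_apply_linear:
  fixes T :: "'a::real_normed_vector \<Rightarrow> 'b::euclidean_space \<Rightarrow> 'c::real_normed_vector"
  assumes X: "open X" "a \<in> X" and lin: "\<And>u. u \<in> X \<Longrightarrow> linear (T u)"
    and T: "\<And>y. ((\<lambda>u. T u y) has_derivative T' y) (at a)"
    and h: "(h has_derivative h') (at a)"
  shows "((\<lambda>u. T u (h u)) has_derivative (\<lambda>x. T' (h a) x + T a (h' x))) (at a)"
proof -
  have lin': "linear (\<lambda>y. T' y x)" for x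
    by (rule linear_parameter_derivative[OF X lin T])
  have hi: "((\<lambda>u. h u \<bullet> i) has_derivative (\<lambda>x. h' x \<bullet> i)) (at a)" for i
    by (rule bounded_linear.has_derivative[OF bounded_linear_inner_left h])
  have "((\<lambda>u. \<Sum>i\<in>Basis. (h u \<bullet> i) *\<^sub>R T u i) has_derivative
      (\<lambda>x. \<Sum>i\<in>Basis. (h a \<bullet> i) *\<^sub>R T' i x + (h' x \<bullet> i) *\<^sub>R T a i)) (at a)"
    by (intro has_derivative_sum has_derivative_scaleR hi T)
  then have "((\<lambda>u. T u (h u)) has_derivative
      (\<lambda>x. \<Sum>i\<in>Basis. (h a \<bullet> i) *\<^sub>R T' i x + (h' x \<bullet> i) *\<^sub>R T a i)) (at a)"
    by (rule has_derivative_transform_within_open[OF _ X])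
      (simp add: linear_euclidean_expansion[OF lin, symmetric])
  moreover have "(\<Sum>i\<in>Basis. (h a \<bullet> i) *\<^sub>R T' i x + (h' x \<bullet> i) *\<^sub>R T a i) = T' (h a) x + T a (h' x)" for x
    using linear_euclidean_expansion[OF lin', of "h a" x] linear_euclidean_expansion[OF lin[OF X(2)], of "h' x"]
    by (simp add: sum.distrib)
  ultimately show ?thesis by simp
qed

section \<open>Vanishing derivatives and constancy\<close>

lemma chart_zero_derivative_locally_constant:
  assumes M: "smooth_manifold A" and c: "c \<in> A" "p \<in> fst c" and T: "open T" "p \<in> T"
    and d: "\<And>q. q \<in> fst c \<inter> T \<Longrightarrow> ((\<lambda>u. \<psi> (chart_inv c u)) has_derivative (\<lambda>v. 0)) (at (snd c q))"
  obtains W where "open W" "p \<in> W" "W \<subseteq> T" "\<And>q. q \<in> W \<Longrightarrow> \<psi> q = \<psi> p"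
proof -
  have "open (snd c ` (fst c \<inter> T))" by (rule chart_image_open[OF M c(1) T(1)])
  moreover have "snd c p \<in> snd c ` (fst c \<inter> T)" using c T by blast
  ultimately obtain e where e: "e > 0" "ball (snd c p) e \<subseteq> snd c ` (fst c \<inter> T)"
    by (meson openE)
  \<comment> \<open>A coordinate ball is convex, so the Euclidean zero-derivative theorem applies
    there; injectivity of the chart then carries the conclusion back to the manifold.\<close>
  have const: "\<psi> (chart_inv c u) = \<psi> (chart_inv c (snd c p))" if "u \<in> ball (snd c p) e" for u
  proof (rule has_derivative_zero_unique[OF convex_ball[of "snd c p" e] _ that])
    fix w assume "w \<in> ball (snd c p) e"
    then obtain q where "q \<in> fst c \<inter> T" "w = snd c q" using e(2) by blast
    then show "((\<lambda>u. \<psi> (chart_inv c u)) has_derivative (\<lambda>h. 0)) (at w within ball (snd c p) e)"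
      using d by (simp add: has_derivative_at_withinI)
  qed (use e(1) in simp)
  show thesis
  proof (rule that[of "snd c -` ball (snd c p) e \<inter> fst c \<inter> T"])
    have "open (snd c -` ball (snd c p) e \<inter> fst c)"
      using chart_continuous(1)[OF M c(1)] continuous_on_open_vimage[OF chart_open[OF M c(1)]] open_ball by blast
    then show "open (snd c -` ball (snd c p) e \<inter> fst c \<inter> T)" using T(1) by (rule open_Int)
    show "p \<in> snd c -` ball (snd c p) e \<inter> fst c \<inter> T" using e(1) c T by simp
    show "\<psi> q = \<psi> p" if "q \<in> snd c -` ball (snd c p) e \<inter> fst c \<inter> T" for q
      using const[of "snd c q"] that chart_inv_left[OF M c(1)] c(2) by auto
  qed blast
qed

lemma locally_constant_UNIV:
  assumes "connected (UNIV :: 'a::topological_space set)"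
    and "\<And>p. \<exists>W. open W \<and> p \<in> W \<and> (\<forall>q\<in>W. f q = f p)"
  shows "f (p :: 'a) = f q"
proof (rule connected_local_const[OF assms(1)])
  show "\<forall>a\<in>UNIV. \<forall>\<^sub>F b in at a. f a = f b"
    unfolding eventually_at_topological using assms(2) by metis
qed auto

text \<open>The hypothesis ranges over all charts because the points near p are differentiated in
  the charts chosen at p and k p, not in those chosen at the nearby points themselves.\<close>

lemma smooth_map_zero_derivative_constant:
  assumes M: "smooth_manifold A" "smooth_manifold B" and k: "smooth_map A B k"
    and conn: "connected (UNIV :: 'm set)"
    and zero: "\<And>d e q v. d \<in> A \<Longrightarrow> e \<in> B \<Longrightarrow> q \<in> fst d \<Longrightarrow> k q \<in> fst e \<Longrightarrow> chart_deriv d e k q v = 0"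
  shows "k (p :: 'm::{t2_space,second_countable_topology}) = k q"
proof (rule locally_constant_UNIV[OF conn])
  fix p
  let ?d = "chart_at A p" and ?e = "chart_at B (k p)"
  have d: "?d \<in> A" "p \<in> fst ?d" and e: "?e \<in> B" "k p \<in> fst ?e"
    using chart_at[OF M(1)] chart_at[OF M(2)] by auto
  have T: "open (k -` fst ?e)" "p \<in> k -` fst ?e"
    using open_vimage[OF chart_open[OF M(2) e(1)] smooth_map_continuous[OF k]] e(2) by auto
  have "((\<lambda>u. snd ?e (k (chart_inv ?d u))) has_derivative (\<lambda>v. 0)) (at (snd ?d q))"
    if "q \<in> fst ?d \<inter> k -` fst ?e" for q
  proof -
    have "chart_deriv ?d ?e k q = (\<lambda>v. 0)" using zero[OF d(1) e(1)] that by auto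
    then show ?thesis using chart_deriv_works[OF k d(1) e(1), of q] that by simp
  qed
  from chart_zero_derivative_locally_constant[where \<psi> = "\<lambda>x. snd ?e (k x)", OF M(1) d T this]
  obtain W where W: "open W" "p \<in> W" "W \<subseteq> k -` fst ?e" "\<And>q. q \<in> W \<Longrightarrow> snd ?e (k q) = snd ?e (k p)"
    by metis
  have "k q = k p" if "q \<in> W" for q
    using inj_onD[OF chart_inj_on[OF M(2) e(1)] W(4)[OF that]] that W(3) e(2) by auto
  with W show "\<exists>W. open W \<and> p \<in> W \<and> (\<forall>q\<in>W. k q = k p)" by blast
qed

text \<open>The constant loops at a and b are freely homotopic. The image of the square under the
  homotopy is a connected set containing both points.\<close>

lemma simply_connected_UNIV_imp_connected:
  assumes "simply_connected (UNIV :: 'a::topological_space set)"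
  shows "connected (UNIV :: 'a set)"
  unfolding connected_iff_connected_component
proof (intro ballI)
  fix a b :: 'a
  have "homotopic_loops UNIV (\<lambda>_. a) (\<lambda>_. b)"
    using assms by (auto simp: simply_connected_def path_def pathstart_def pathfinish_def)
  then obtain h :: "real \<times> real \<Rightarrow> 'a" where h: "continuous_on ({0..1} \<times> {0..1}) h"
      "\<forall>x\<in>{0..1}. h (0, x) = a" "\<forall>x\<in>{0..1}. h (1, x) = b"
    unfolding homotopic_loops by blast
  have "connected (h ` ({0..1} \<times> {0..1}))"
    by (intro connected_continuous_image h connected_Times connected_Icc)
  moreover have "a \<in> h ` ({0..1} \<times> {0..1})" "b \<in> h ` ({0..1} \<times> {0..1})"
    using h(2,3) by (intro image_eqI[of _ _ "(0, 0)"] image_eqI[of _ _ "(1, 0)"]; simp)+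
  ultimately show "connected_component UNIV a b"
    unfolding connected_component_def by blast
qed

section \<open>Left trivialized differentials on Lie groups\<close>

locale lie_group_manifold =
  fixes N :: "'g::{t2_space,second_countable_topology} monoid" (structure)
    and A :: "('g, 'e::euclidean_space) atlas"
  assumes lie_group: "lie_group N A"
begin

sublocale group N
  using lie_group by (simp add: lie_group_def)

lemma carrier_UNIV [simp]: "carrier N = UNIV"
  using lie_group by (simp add: lie_group_def)

lemma manifold: "smooth_manifold A"
  and manifold_prod: "smooth_manifold (prod_atlas A A)"
  using lie_group smooth_manifold_prod by (auto simp: lie_group_def)

lemma smooth_mult:
  assumes "smooth_manifold B" "smooth_map B A f" "smooth_map B A h"
  shows "smooth_map B A (\<lambda>x. f x \<otimes> h x)"
proof -
  have "smooth_map (prod_atlas A A) A (\<lambda>z. fst z \<otimes> snd z)"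
    using lie_group by (simp add: lie_group_def case_prod_beta')
  from smooth_map_compose[OF assms(1) manifold_prod manifold smooth_map_Pair[OF assms(1) manifold manifold assms(2,3)] this]
  show ?thesis by simp
qed

lemma smooth_inv:
  assumes "smooth_manifold B" "smooth_map B A f"
  shows "smooth_map B A (\<lambda>x. inv (f x))"
  using smooth_map_compose[OF assms(1) manifold manifold assms(2)] lie_group by (simp add: lie_group_def)

lemma smooth_left: "smooth_map A A (\<lambda>x. a \<otimes> x)"
  by (intro smooth_mult manifold smooth_map_const smooth_map_id)

text \<open>The left logarithmic difference of \<open>f\<close>: its derivative in \<open>y\<close> at the identity is the
  differential of \<open>f\<close> at \<open>x\<close> in the left trivialization.\<close>

definition left_diff :: "('g \<Rightarrow> 'g) \<Rightarrow> 'g \<Rightarrow> 'g \<Rightarrow> 'g" where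
  "left_diff f x y = inv (f x) \<otimes> f (x \<otimes> y)"

definition left_deriv :: "('g \<Rightarrow> 'g) \<Rightarrow> 'g \<Rightarrow> 'e \<Rightarrow> 'e" where
  "left_deriv f q = mderiv A A (left_diff f q) \<one>"

lemma left_diff_one [simp]: "left_diff f q \<one> = \<one>"
  by (simp add: left_diff_def l_inv)

lemma mult_left_diff: "f x \<otimes> left_diff f x y = f (x \<otimes> y)"
  by (simp add: left_diff_def m_assoc[symmetric] r_inv)

text \<open>The factor f q cancels between the two differences. This change of base point is what
  transports results at the identity to an arbitrary q.\<close>

lemma left_diff_left_diff: "left_diff (left_diff f q) x y = left_diff f (q \<otimes> x) y"
proof -
  have "inv (inv a \<otimes> b) \<otimes> (inv a \<otimes> c) = inv b \<otimes> c" for a b c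
  proof -
    have "inv (inv a \<otimes> b) \<otimes> (inv a \<otimes> c) = inv b \<otimes> (a \<otimes> (inv a \<otimes> c))"
      by (simp add: inv_mult_group m_assoc)
    also have "a \<otimes> (inv a \<otimes> c) = c" using m_assoc[of a "inv a" c] by simp
    finally show ?thesis .
  qed
  then show ?thesis by (simp add: left_diff_def m_assoc)
qed

lemma smooth_left_diff:
  assumes "smooth_map A A f"
  shows "smooth_map (prod_atlas A A) A (\<lambda>z. left_diff f (fst z) (snd z))" "smooth_map A A (left_diff f q)"
proof -
  note fs = smooth_map_fst_snd[OF manifold manifold]
  show "smooth_map (prod_atlas A A) A (\<lambda>z. left_diff f (fst z) (snd z))"
    unfolding left_diff_def
    by (intro smooth_mult smooth_inv smooth_map_compose[OF manifold_prod manifold manifold _ assms] manifold_prod fs)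
  show "smooth_map A A (left_diff f q)"
    unfolding left_diff_def
    by (intro smooth_mult smooth_inv smooth_map_const smooth_map_compose[OF manifold manifold manifold _ assms] smooth_left manifold)
qed

abbreviation c0 :: "('g, 'e) chart" where "c0 \<equiv> chart_at A \<one>"
abbreviation u0 :: 'e where "u0 \<equiv> snd c0 \<one>"
abbreviation X0 :: "'e set" where "X0 \<equiv> snd c0 ` fst c0"

lemma c0: "c0 \<in> A" "\<one> \<in> fst c0"
  using chart_at[OF manifold] by auto

lemma X0: "open X0" "u0 \<in> X0"
  using chart_image_open[OF manifold c0(1) open_UNIV] c0 by auto

lemma chart_inv_u0 [simp]: "chart_inv c0 u0 = \<one>"
  by (rule chart_inv_left[OF manifold c0])

lemma left_deriv_chart_deriv: "left_deriv f q = chart_deriv c0 c0 (left_diff f q) \<one>"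
  by (simp add: left_deriv_def mderiv_chart_deriv)

lemma left_deriv_left_diff: "left_deriv (left_diff f q) x = left_deriv f (q \<otimes> x)"
proof -
  have "left_diff (left_diff f q) x = left_diff f (q \<otimes> x)"
    by (rule ext) (rule left_diff_left_diff)
  then show ?thesis by (simp add: left_deriv_def)
qed

lemma linear_left_deriv: "smooth_map A A f \<Longrightarrow> linear (left_deriv f q)"
  unfolding left_deriv_def by (intro linear_mderiv manifold smooth_left_diff)

lemma left_deriv_eq:
  assumes "smooth_map A A f"
  shows "left_deriv f q y =
    mderiv A A (\<lambda>x. inv (f q) \<otimes> x) (f q) (mderiv A A f q (mderiv A A (\<lambda>x. q \<otimes> x) \<one> y))"
proof -
  have "left_deriv f q y = mderiv A A (\<lambda>x. inv (f q) \<otimes> x) (f (q \<otimes> \<one>)) (mderiv A A (\<lambda>x. f (q \<otimes> x)) \<one> y)"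
    unfolding left_deriv_def left_diff_def
    by (rule mderiv_compose[OF manifold manifold manifold smooth_map_compose[OF manifold manifold manifold smooth_left assms] smooth_left])
  also have "mderiv A A (\<lambda>x. f (q \<otimes> x)) \<one> y = mderiv A A f (q \<otimes> \<one>) (mderiv A A (\<lambda>x. q \<otimes> x) \<one> y)"
    by (rule mderiv_compose[OF manifold manifold manifold smooth_left assms])
  finally show ?thesis by simp
qed

text \<open>Smoothness of each single map \<open>H q\<close> would not give smooth dependence of its
  differential on q. Joint smoothness does: the differential is the derivative of the two-variable
  coordinate expression \<open>K\<close> in the direction (0, y), restricted to the slice of points
  (u, u0).\<close>

lemma smooth_partial:
  assumes H: "smooth_map (prod_atlas A A) A (\<lambda>z. H (fst z) (snd z))" and d: "d \<in> A"
    and one: "\<And>q. q \<in> fst d \<Longrightarrow> H q \<one> \<in> fst c0"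
  shows "smooth_on (snd d ` fst d) (\<lambda>u. chart_deriv c0 c0 (H (chart_inv d u)) \<one> y)"
proof -
  let ?k = "(fst d \<times> fst c0, map_prod (snd d) (snd c0))"
  let ?H = "\<lambda>z. H (fst z) (snd z)"
  let ?X = "snd ?k ` (fst ?k \<inter> ?H -` fst c0)"
  define K where "K z = snd c0 (H (chart_inv d (fst z)) (chart_inv c0 (snd z)))" for z
  have k: "?k \<in> prod_atlas A A" using d c0 unfolding prod_atlas_def by blast
  have oX: "open ?X" by (rule smooth_map_domain_open[OF manifold_prod manifold H k c0(1)])
  have sub: "?X \<subseteq> snd d ` fst d \<times> X0" by auto
  have od: "open (snd d ` fst d)" using chart_image_open[OF manifold d open_UNIV] by simp
  have "smooth_on ?X (\<lambda>z. snd c0 (?H (chart_inv ?k z)))"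
    by (rule smooth_map_on_charts[OF H k c0(1)])
  then have K: "smooth_on ?X K"
  proof (rule smooth_on_cong[OF oX])
    fix z assume "z \<in> ?X"
    then have "z \<in> snd d ` fst d \<times> snd c0 ` fst c0" using sub by blast
    from chart_inv_prod[OF manifold manifold d c0(1) this]
    show "snd c0 (?H (chart_inv ?k z)) = K z" by (simp add: K_def)
  qed
  have in_X: "(u, u0) \<in> ?X" if u: "u \<in> snd d ` fst d" for u
  proof -
    obtain q where q: "q \<in> fst d" "u = snd d q" using u by blast
    show ?thesis using q one[OF q(1)] c0(2) by (intro image_eqI[of _ _ "(q, \<one>)"]) auto
  qed
  have eq: "frechet_derivative K (at (u, u0)) (0, y) = chart_deriv c0 c0 (H (chart_inv d u)) \<one> y"
    if u: "u \<in> snd d ` fst d" for u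
  proof -
    have "((\<lambda>w. K (u, w)) has_derivative (\<lambda>y. frechet_derivative K (at (u, u0)) (0, y))) (at u0)"
    proof (rule has_derivative_compose[where g = K and f = "\<lambda>w. (u, w)"
          and g' = "frechet_derivative K (at (u, u0))"])
      show "((\<lambda>w. (u, w)) has_derivative (\<lambda>y. (0, y))) (at u0)"
        by (intro has_derivative_Pair has_derivative_const has_derivative_ident)
      show "(K has_derivative frechet_derivative K (at (u, u0))) (at (u, u0))"
        by (rule smooth_on_has_derivative[OF K in_X[OF u]])
    qed
    from frechet_derivative_at[OF this] show ?thesis
      unfolding chart_deriv_def K_def by (simp add: fun_eq_iff)
  qed
  have "smooth_on (snd d ` fst d) (\<lambda>u. (\<lambda>z. frechet_derivative K (at z) (0, y)) (u, u0))"
    by (rule smooth_on_compose[OF od oX smooth_on_Pair[OF od smooth_on_bounded_linear[OF od bounded_linear_ident] smooth_on_const]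
        smooth_on_frechet_derivative[OF K]]) (use in_X in blast)
  then show ?thesis by (rule smooth_on_cong[OF od]) (rule eq)
qed

lemma smooth_left_deriv:
  assumes "smooth_map A A f" "d \<in> A"
  shows "smooth_on (snd d ` fst d) (\<lambda>u. left_deriv f (chart_inv d u) y)"
  unfolding left_deriv_chart_deriv
  by (rule smooth_partial[OF smooth_left_diff(1)[OF assms(1)] assms(2)]) (simp add: c0)

text \<open>The left-invariant fields in the chart at the identity.\<close>

definition frame :: "'e \<Rightarrow> 'e \<Rightarrow> 'e" where
  "frame u y = chart_deriv c0 c0 (\<lambda>x. chart_inv c0 u \<otimes> x) \<one> y"

lemma smooth_frame: "smooth_on X0 (\<lambda>u. frame u y)"
  unfolding frame_def
proof (rule smooth_partial[OF _ c0(1)])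
  show "smooth_map (prod_atlas A A) A (\<lambda>z. fst z \<otimes> snd z)"
    by (intro smooth_mult manifold_prod smooth_map_fst_snd manifold)
qed simp

lemma linear_frame: "u \<in> X0 \<Longrightarrow> linear (frame u)"
  unfolding frame_def
  by (rule linear_chart_deriv[OF smooth_left c0(1) c0(1) c0(2)]) (simp add: chart_inv_in)

lemma frame_u0 [simp]: "frame u0 y = y"
  using chart_deriv_id[OF manifold c0] by (simp add: frame_def)

text \<open>The field is stored in the components of the chart chosen at p, and
  \<open>to_coords\<close> translates them to \<open>c0\<close>. By the chain rule with the identity
  map, the arbitrary chart at p drops out.\<close>

lemma field_in_chart_frame:
  assumes "u \<in> X0"
  shows "field_in_chart A c0 (left_invariant_field N A x) u = frame u x"
proof -
  let ?p = "chart_inv c0 u"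
  have p: "?p \<in> fst c0" using assms by (rule chart_inv_in)
  have "chart_deriv c0 c0 (\<lambda>y. ?p \<otimes> y) \<one> x =
      chart_deriv (chart_at A (?p \<otimes> \<one>)) c0 (\<lambda>y. y) (?p \<otimes> \<one>) (chart_deriv c0 (chart_at A (?p \<otimes> \<one>)) (\<lambda>y. ?p \<otimes> y) \<one> x)"
    by (rule chart_deriv_compose[OF manifold manifold smooth_left smooth_map_id[OF manifold] c0]) (use p in \<open>auto intro: chart_at manifold c0\<close>)
  then show ?thesis
    by (simp add: field_in_chart_def left_invariant_field_def left_translation_def frame_def
        to_coords_chart_deriv mderiv_chart_deriv)
qed

definition frame' :: "'e \<Rightarrow> 'e \<Rightarrow> 'e" where
  "frame' y = frechet_derivative (\<lambda>u. frame u y) (at u0)"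

lemma frame': "((\<lambda>u. frame u y) has_derivative frame' y) (at u0)"
  unfolding frame'_def by (rule smooth_on_has_derivative[OF smooth_frame X0(2)])

text \<open>At \<open>u0\<close> the frame is the identity, so the coordinate bracket reduces to the
  antisymmetrized first derivative of the frame.\<close>

lemma lie_bracket_frame: "lie_bracket N A x y = frame' y x - frame' x y"
proof -
  have "frechet_derivative (field_in_chart A c0 (left_invariant_field N A z)) (at u0) = frame' z" for z
  proof -
    have "(field_in_chart A c0 (left_invariant_field N A z) has_derivative frame' z) (at u0)"
      by (rule has_derivative_transform_within_open[OF frame' X0]) (simp add: field_in_chart_frame)
    from frechet_derivative_at[OF this] show ?thesis by simp
  qed
  then show ?thesis
    by (simp add: lie_bracket_def vf_bracket_def Let_def field_in_chart_frame[OF X0(2)])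
qed

lemma linear_frame':
  "linear (frame' y)" "linear (\<lambda>y. frame' y x)"
  using has_derivative_linear[OF frame'] linear_parameter_derivative[OF X0 linear_frame frame'] by auto

lemma bracket_simps:
  "lie_bracket N A (x + x') y = lie_bracket N A x y + lie_bracket N A x' y"
  "lie_bracket N A x (y + y') = lie_bracket N A x y + lie_bracket N A x y'"
  "lie_bracket N A (c *\<^sub>R x) y = c *\<^sub>R lie_bracket N A x y"
  "lie_bracket N A 0 y = 0"
  by (simp_all add: lie_bracket_frame linear_add[OF linear_frame'(1)] linear_add[OF linear_frame'(2)]
      linear_cmul[OF linear_frame'(1)] linear_cmul[OF linear_frame'(2)] linear_0[OF linear_frame'(1)]
      linear_0[OF linear_frame'(2)] scaleR_diff_right)

lemma subspace_center: "subspace (lie_center N A)"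
  unfolding subspace_def lie_center_def by (simp add: bracket_simps)

lemma bracket_center: "x \<in> lie_center N A \<Longrightarrow> lie_bracket N A x y = 0"
  by (simp add: lie_center_def)

text \<open>The Maurer-Cartan equation pulled back along \<open>f\<close>.\<close>

lemma structure_equation:
  assumes f: "smooth_map A A f" and f1: "f \<one> = \<one>"
    and \<alpha>: "\<And>y. ((\<lambda>u. left_deriv f (chart_inv c0 u) y) has_derivative \<alpha> y) (at u0)"
  shows "left_deriv f \<one> (lie_bracket N A x y) + \<alpha> x y
    = lie_bracket N A (left_deriv f \<one> x) (left_deriv f \<one> y) + \<alpha> y x"
proof -
  define F where "F u = snd c0 (f (chart_inv c0 u))" for u
  let ?X = "snd c0 ` (fst c0 \<inter> f -` fst c0)"
  let ?F' = "\<lambda>u. frechet_derivative F (at u)"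
  have X: "open ?X" "u0 \<in> ?X" using smooth_map_domain_open[OF manifold manifold f c0(1) c0(1)] c0 f1 by auto
  have sub: "?X \<subseteq> X0" by blast
  have F: "smooth_on ?X F"
    using smooth_map_on_charts[OF f c0(1) c0(1)] unfolding F_def .
  have Fu0: "F u0 = u0" by (simp add: F_def f1)
  have F_in: "F u \<in> X0" "chart_inv c0 (F u) = f (chart_inv c0 u)" "chart_inv c0 u \<in> fst c0" 
    "f (chart_inv c0 u) \<in> fst c0" if "u \<in> ?X" for u
    using that by (auto simp: F_def chart_inv_left[OF manifold c0(1)])
  have dF: "chart_deriv c0 c0 f (chart_inv c0 u) = ?F' u" if "u \<in> ?X" for u
  proof -
    have "snd c0 (chart_inv c0 u) = u" using that sub by (intro chart_inv_right) blast
    moreover have "F = (\<lambda>u. snd c0 (f (chart_inv c0 u)))" by (simp add: F_def fun_eq_iff)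
    ultimately show ?thesis by (simp add: chart_deriv_def)
  qed
  \<comment> \<open>The differential of the identity f (p x) = f p (left_diff f p x) in x: on
    left-invariant fields, df acts through the left derivative followed by the frame at the image
    point.\<close>
  have E: "?F' u (frame u y) = frame (F u) (left_deriv f (chart_inv c0 u) y)" if u: "u \<in> ?X" for u y
  proof -
    let ?p = "chart_inv c0 u"
    have "?F' u (frame u y) = chart_deriv c0 c0 f (?p \<otimes> \<one>) (chart_deriv c0 c0 (\<lambda>x. ?p \<otimes> x) \<one> y)"
      using dF[OF u] by (simp add: frame_def)
    also have "\<dots> = chart_deriv c0 c0 (\<lambda>x. f (?p \<otimes> x)) \<one> y"
      by (rule chart_deriv_compose[OF manifold manifold smooth_left f c0, symmetric]) (use F_in[OF u] c0 in auto)
    also have "(\<lambda>x. f (?p \<otimes> x)) = (\<lambda>x. f ?p \<otimes> left_diff f ?p x)"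
      by (simp add: mult_left_diff)
    also have "chart_deriv c0 c0 \<dots> \<one> y =
        chart_deriv c0 c0 (\<lambda>x. f ?p \<otimes> x) (left_diff f ?p \<one>) (chart_deriv c0 c0 (left_diff f ?p) \<one> y)"
      by (rule chart_deriv_compose[OF manifold manifold smooth_left_diff(2)[OF f] smooth_left c0]) (use F_in[OF u] c0 in auto)
    also have "\<dots> = frame (F u) (left_deriv f ?p y)"
      using F_in[OF u] by (simp add: frame_def left_deriv_chart_deriv)
    finally show ?thesis .
  qed
  have left1: "left_deriv f \<one> y = ?F' u0 y" for y
    using E[OF X(2), of y] by (simp add: Fu0)
  \<comment> \<open>\<open>D\<close> is the second derivative of \<open>F\<close>, the part of the
    differentiated equation \<open>E\<close> that antisymmetrization must remove. What survives are
    the frame derivatives, which form the two brackets, and \<alpha>.\<close>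
  define D where "D y = frechet_derivative (\<lambda>u. ?F' u y) (at u0)" for y
  have L: "((\<lambda>u. ?F' u (frame u y)) has_derivative (\<lambda>x. D (frame u0 y) x + ?F' u0 (frame' y x))) (at u0)" for y
  proof (rule has_derivative_apply_linear[OF X _ _ frame'])
    show "linear (?F' u)" if "u \<in> ?X" for u
      using smooth_on_has_derivative[OF F that] has_derivative_linear by blast
    show "((\<lambda>u. ?F' u y) has_derivative D y) (at u0)" for y
      unfolding D_def by (rule smooth_on_has_derivative[OF smooth_on_frechet_derivative[OF F] X(2)])
  qed
  have R: "((\<lambda>u. frame (F u) (left_deriv f (chart_inv c0 u) y)) has_derivative
      (\<lambda>x. frame' (left_deriv f (chart_inv c0 u0) y) (?F' u0 x) + frame (F u0) (\<alpha> y x))) (at u0)" for y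
  proof (rule has_derivative_apply_linear[OF X _ _ \<alpha>])
    show "linear (frame (F u))" if "u \<in> ?X" for u
      by (rule linear_frame[OF F_in(1)[OF that]])
    show "((\<lambda>u. frame (F u) y) has_derivative (\<lambda>x. frame' y (?F' u0 x))) (at u0)" for y
      by (rule has_derivative_compose[OF smooth_on_has_derivative[OF F X(2)]]) (simp add: Fu0 frame')
  qed
  have "D (frame u0 y) x + ?F' u0 (frame' y x)
      = frame' (left_deriv f (chart_inv c0 u0) y) (?F' u0 x) + frame (F u0) (\<alpha> y x)" for x y
  proof -
    have "((\<lambda>u. ?F' u (frame u y)) has_derivative
      (\<lambda>x. frame' (left_deriv f (chart_inv c0 u0) y) (?F' u0 x) + frame (F u0) (\<alpha> y x))) (at u0)"
      by (rule has_derivative_transform_within_open[OF R X]) (simp add: E)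
    from has_derivative_unique[OF L this] show ?thesis by metis
  qed
  then have eq: "D y x + ?F' u0 (frame' y x) = frame' (?F' u0 y) (?F' u0 x) + \<alpha> y x" for x y
    by (simp add: Fu0 left1)
  have D_sym: "D y x = D x y"
    unfolding D_def by (rule symmetric_second_derivative[OF X F])
  have lin: "linear (?F' u0)"
    using smooth_on_has_derivative[OF F X(2)] has_derivative_linear by blast
  have "?F' u0 (frame' y x) - ?F' u0 (frame' x y)
      = (D y x + ?F' u0 (frame' y x)) - (D x y + ?F' u0 (frame' x y))"
    by (simp add: D_sym)
  also have "\<dots> = (frame' (?F' u0 y) (?F' u0 x) + \<alpha> y x) - (frame' (?F' u0 x) (?F' u0 y) + \<alpha> x y)"
    by (simp only: eq)
  finally show ?thesis
    by (simp add: lie_bracket_frame left1 linear_diff[OF lin] algebra_simps)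
qed

end

section \<open>Invariant subspaces and maps with constant left derivative\<close>

context lie_group_manifold
begin

lemma mderiv_left_inverse:
  "mderiv A A (\<lambda>x. inv p \<otimes> x) p (mderiv A A (\<lambda>x. p \<otimes> x) \<one> y) = y"
  "mderiv A A (\<lambda>x. p \<otimes> x) \<one> (mderiv A A (\<lambda>x. inv p \<otimes> x) p w) = w"
proof -
  have "mderiv A A (\<lambda>x. inv p \<otimes> (p \<otimes> x)) \<one> y = mderiv A A (\<lambda>x. inv p \<otimes> x) (p \<otimes> \<one>) (mderiv A A (\<lambda>x. p \<otimes> x) \<one> y)"
    by (rule mderiv_compose[OF manifold manifold manifold smooth_left smooth_left])
  moreover have "(\<lambda>x. inv p \<otimes> (p \<otimes> x)) = (\<lambda>x. x)" by (simp add: m_assoc[symmetric])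
  ultimately show "mderiv A A (\<lambda>x. inv p \<otimes> x) p (mderiv A A (\<lambda>x. p \<otimes> x) \<one> y) = y"
    using mderiv_id[OF manifold] by simp
  have "mderiv A A (\<lambda>x. p \<otimes> (inv p \<otimes> x)) p w = mderiv A A (\<lambda>x. p \<otimes> x) (inv p \<otimes> p) (mderiv A A (\<lambda>x. inv p \<otimes> x) p w)"
    by (rule mderiv_compose[OF manifold manifold manifold smooth_left smooth_left])
  moreover have "(\<lambda>x. p \<otimes> (inv p \<otimes> x)) = (\<lambda>x. x)" by (simp add: m_assoc[symmetric])
  ultimately show "mderiv A A (\<lambda>x. p \<otimes> x) \<one> (mderiv A A (\<lambda>x. inv p \<otimes> x) p w) = w"
    using mderiv_id[OF manifold] by simp
qed

text \<open>Left translation identifies all fibres of the left-invariant bundle with the one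
  subspace S, so preserving the bundle becomes preserving S at every point.\<close>

lemma left_deriv_image:
  assumes f: "smooth_map A A f"
    and S: "mderiv A A f q ` left_invariant_bundle N A S q = left_invariant_bundle N A S (f q)"
  shows "left_deriv f q ` S = S"
proof -
  have "left_deriv f q ` S = mderiv A A (\<lambda>x. inv (f q) \<otimes> x) (f q) ` (mderiv A A f q ` left_invariant_bundle N A S q)"
    by (simp add: left_deriv_eq[OF f] left_invariant_bundle_def left_translation_def image_image)
  also have "\<dots> = S"
    unfolding S by (simp add: left_invariant_bundle_def left_translation_def image_image mderiv_left_inverse)
  finally show ?thesis .
qed

text \<open>With the quotient \<open>f (a x) f(x)\<^sup>-\<^sup>1\<close>, and not \<open>f(x)\<^sup>-\<^sup>1 f (a x)\<close>, the two equal left derivatives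
  meet next to each other and cancel, without any conjugation.\<close>

lemma left_deriv_const_hom:
  assumes f: "smooth_map A A f" and conn: "connected (UNIV :: 'g set)"
    and const: "\<And>p q. left_deriv f p = left_deriv f q"
  shows "f (a \<otimes> x) = f a \<otimes> inv (f \<one>) \<otimes> f x"
proof -
  define k where "k x = f (a \<otimes> x) \<otimes> inv (f x)" for x
  have sk: "smooth_map A A k"
    unfolding k_def by (intro smooth_mult smooth_inv smooth_map_compose[OF manifold manifold manifold smooth_left f] f manifold)
  have "k x = k \<one>"
  proof (rule smooth_map_zero_derivative_constant[OF manifold manifold sk conn])
    fix d e q v assume d: "d \<in> A" "q \<in> fst d" and e: "e \<in> A" "k q \<in> fst e"
    \<comment> \<open>With x = q y, the expansions of f (a x) and f x around a q and q put f (a q)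
      and the inverse of f q at the two ends of \<open>k x\<close>. The map \<open>l\<close>
      collects these outer factors, so it remains to see that \<open>\<mu>\<close> has zero
      differential at the identity.\<close>
    define \<mu> where "\<mu> y = left_diff f (a \<otimes> q) y \<otimes> inv (left_diff f q y)" for y
    define l where "l y = f (a \<otimes> q) \<otimes> (y \<otimes> inv (f q))" for y
    have s\<mu>: "smooth_map A A \<mu>"
      unfolding \<mu>_def by (intro smooth_mult smooth_inv smooth_left_diff f manifold)
    have sl: "smooth_map A A l"
      unfolding l_def by (intro smooth_mult smooth_map_const smooth_map_id manifold)
    have \<mu>1: "\<mu> \<one> = \<one>" by (simp add: \<mu>_def)
    have k_eq: "k = (\<lambda>x. l (\<mu> (inv q \<otimes> x)))"
    proof
      fix x
      have 1: "f (a \<otimes> x) = f (a \<otimes> q) \<otimes> left_diff f (a \<otimes> q) (inv q \<otimes> x)"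
        by (simp add: mult_left_diff m_assoc) (simp add: m_assoc[symmetric])
      have 2: "f x = f q \<otimes> left_diff f q (inv q \<otimes> x)"
        by (simp add: mult_left_diff) (simp add: m_assoc[symmetric])
      show "k x = l (\<mu> (inv q \<otimes> x))"
        unfolding k_def l_def \<mu>_def by (subst 1, subst 2) (simp add: inv_mult_group m_assoc)
    qed
    have lq: "l \<one> \<in> fst e"
      using e(2) \<mu>1 by (simp add: k_eq)
    have zero: "chart_deriv c0 c0 \<mu> \<one> w = 0" for w
    proof -
      let ?m = "\<lambda>z. fst z \<otimes> inv (snd z)" and ?k = "(fst c0 \<times> fst c0, map_prod (snd c0) (snd c0))"
      define K where "K z = snd c0 (chart_inv c0 (fst z) \<otimes> inv (chart_inv c0 (snd z)))" for z
      have sm: "smooth_map (prod_atlas A A) A ?m"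
        by (intro smooth_mult smooth_inv smooth_map_fst_snd manifold manifold_prod)
      have kk: "?k \<in> prod_atlas A A" using c0 unfolding prod_atlas_def by blast
      let ?X = "snd ?k ` (fst ?k \<inter> ?m -` fst c0)"
      have oX: "open ?X" by (rule smooth_map_domain_open[OF manifold_prod manifold sm kk c0(1)])
      have "smooth_on ?X (\<lambda>z. snd c0 (?m (chart_inv ?k z)))"
        by (rule smooth_map_on_charts[OF sm kk c0(1)])
      then have sK: "smooth_on ?X K"
      proof (rule smooth_on_cong[OF oX])
        fix z assume "z \<in> ?X"
        then have "z \<in> X0 \<times> X0" by auto
        from chart_inv_prod[OF manifold manifold c0(1) c0(1) this]
        show "snd c0 (?m (chart_inv ?k z)) = K z" by (simp add: K_def)
      qed
      have in_X: "(u0, u0) \<in> ?X"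
        using c0(2) by (intro image_eqI[of _ _ "(\<one>, \<one>)"]) auto
      define K' where "K' = frechet_derivative K (at (u0, u0))"
      have K': "(K has_derivative K') (at (u0, u0))"
        unfolding K'_def by (rule smooth_on_has_derivative[OF sK in_X])
      \<comment> \<open>\<open>K\<close> is (x, y) \<mapsto> x y^{-1} in coordinates. It is constant
        on the diagonal, so its differential kills all vectors (w, w).\<close>
      have diag: "K' (w, w) = 0" for w
      proof -
        have "((\<lambda>u. K (u, u)) has_derivative (\<lambda>w. K' (w, w))) (at u0)"
          by (rule has_derivative_compose[where g = K and f = "\<lambda>u. (u, u)" and g' = K', OF _ K'])
            (intro has_derivative_Pair has_derivative_ident)
        moreover have "((\<lambda>u. K (u, u)) has_derivative (\<lambda>w. 0)) (at u0)"
          by (rule has_derivative_transform_within_open[OF has_derivative_const[of u0] X0]) (simp add: K_def)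
        ultimately have "(\<lambda>w. K' (w, w)) = (\<lambda>w. 0)" by (rule has_derivative_unique)
        then show ?thesis by metis
      qed
      let ?h1 = "left_diff f (a \<otimes> q)" and ?h2 = "left_diff f q"
      define H1 where "H1 u = snd c0 (?h1 (chart_inv c0 u))" for u
      define H2 where "H2 u = snd c0 (?h2 (chart_inv c0 u))" for u
      \<comment> \<open>Here constancy of the left derivative is used: the difference based at a q
        has the same differential as the one based at q, so the pair (H1, H2) moves in a diagonal
        direction.\<close>
      have H1: "(H1 has_derivative left_deriv f q) (at u0)"
        unfolding H1_def const[of q "a \<otimes> q", unfolded left_deriv_chart_deriv[of f "a \<otimes> q"]]
        by (rule chart_deriv_works[OF smooth_left_diff(2)[OF f] c0(1) c0(1)]) (simp_all add: c0)
      have H2: "(H2 has_derivative left_deriv f q) (at u0)"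
        unfolding H2_def left_deriv_chart_deriv
        by (rule chart_deriv_works[OF smooth_left_diff(2)[OF f] c0(1) c0(1)]) (simp_all add: c0)
      have "((\<lambda>u. K (H1 u, H2 u)) has_derivative (\<lambda>w. K' (left_deriv f q w, left_deriv f q w))) (at u0)"
      proof (rule has_derivative_compose[where g = K and f = "\<lambda>u. (H1 u, H2 u)" and g' = K'])
        show "((\<lambda>u. (H1 u, H2 u)) has_derivative (\<lambda>w. (left_deriv f q w, left_deriv f q w))) (at u0)"
          by (intro has_derivative_Pair H1 H2)
        show "(K has_derivative K') (at (H1 u0, H2 u0))"
          using K' by (simp add: H1_def H2_def)
      qed
      then have "((\<lambda>u. snd c0 (\<mu> (chart_inv c0 u))) has_derivative (\<lambda>w. K' (left_deriv f q w, left_deriv f q w))) (at u0)"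
      proof (rule has_derivative_transform_within_open)
        let ?Y = "snd c0 ` (fst c0 \<inter> (?h1 -` fst c0 \<inter> ?h2 -` fst c0))"
        show "open ?Y"
          by (intro chart_image_open[OF manifold c0(1)] open_Int open_vimage chart_open[OF manifold c0(1)]
              smooth_map_continuous[OF smooth_left_diff(2)[OF f]])
        show "u0 \<in> ?Y" using c0(2) by auto
        show "K (H1 u, H2 u) = snd c0 (\<mu> (chart_inv c0 u))" if "u \<in> ?Y" for u
          using that by (auto simp: K_def H1_def H2_def \<mu>_def chart_inv_left[OF manifold c0(1)])
      qed
      from frechet_derivative_at[OF this] show ?thesis
        unfolding chart_deriv_def by (metis diag)
    qed
    have qq: "inv q \<otimes> q = \<one>" by simp
    have "chart_deriv d e k q v = chart_deriv c0 e (\<lambda>x. l (\<mu> x)) (inv q \<otimes> q) (chart_deriv d c0 (\<lambda>x. inv q \<otimes> x) q v)"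
      unfolding k_eq
      by (rule chart_deriv_compose[OF manifold manifold smooth_left smooth_map_compose[OF manifold manifold manifold s\<mu> sl] d c0(1) _ e(1)])
        (use c0(2) lq \<mu>1 in auto)
    also have "\<dots> = chart_deriv c0 e l (\<mu> \<one>) (chart_deriv c0 c0 \<mu> \<one> (chart_deriv d c0 (\<lambda>x. inv q \<otimes> x) q v))"
      unfolding qq
      by (rule chart_deriv_compose[OF manifold manifold s\<mu> sl c0 c0(1) _ e(1)]) (use c0(2) lq \<mu>1 in auto)
    also have "\<dots> = 0"
      using linear_0[OF linear_chart_deriv[OF sl c0(1) e(1) c0(2) lq]] by (simp add: zero \<mu>1)
    finally show "chart_deriv d e k q v = 0" .
  qed
  then have "f (a \<otimes> x) \<otimes> inv (f x) = f a \<otimes> inv (f \<one>)" by (simp add: k_def)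
  then have "f (a \<otimes> x) \<otimes> inv (f x) \<otimes> f x = f a \<otimes> inv (f \<one>) \<otimes> f x" by simp
  then show ?thesis by (simp add: m_assoc)
qed

end

section \<open>Isometries preserving the splitting\<close>

locale nilpotent_splitting = lie_group_manifold N A
  for N :: "'g::{t2_space,second_countable_topology} monoid" (structure)
    and A :: "('g, 'e::euclidean_space) atlas" +
  fixes g :: "'g \<Rightarrow> 'e \<Rightarrow> 'e \<Rightarrow> real" and V :: "'e set"
  assumes conn: "connected (UNIV :: 'g set)"
    and two_step: "two_step_nilpotent N A"
    and metric: "pseudo_riemannian_metric A g"
    and left_inv: "left_invariant_metric N A g"
    and V: "admissible_V (g \<one>) (lie_center N A) V"
begin

abbreviation \<zz> where "\<zz> \<equiv> lie_center N A"
abbreviation \<vv> where "\<vv> \<equiv> v_space (g \<one>) \<zz> V"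

lemma metric_inner_product: "inner_product (g p)"
  using metric by (simp add: pseudo_riemannian_metric_def)

lemmas splitting = z_Int_v[OF metric_inner_product subspace_center V] z_plus_v[OF metric_inner_product subspace_center V]
  subspace_v[OF metric_inner_product subspace_center V]

lemma left_mult_isometric:
  "g (a \<otimes> p) (mderiv A A (\<lambda>x. a \<otimes> x) p u) (mderiv A A (\<lambda>x. a \<otimes> x) p v) = g p u v"
  using left_inv by (simp add: left_invariant_metric_def left_translation_def)

lemma isometry_smooth: "f \<in> isometries A g \<Longrightarrow> smooth_map A A f"
  by (simp add: isometries_def)

lemma left_deriv_isometric:
  assumes f: "f \<in> isometries A g"
  shows "g \<one> (left_deriv f q x) (left_deriv f q y) = g \<one> x y"
proof -
  have "g \<one> (left_deriv f q x) (left_deriv f q y) = g (inv (f q) \<otimes> f q) (left_deriv f q x) (left_deriv f q y)"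
    by simp
  also have "\<dots> = g q (mderiv A A (\<lambda>x. q \<otimes> x) \<one> x) (mderiv A A (\<lambda>x. q \<otimes> x) \<one> y)"
    unfolding left_deriv_eq[OF isometry_smooth[OF f]] left_mult_isometric
    using f by (simp add: isometries_def)
  also have "\<dots> = g \<one> x y" using left_mult_isometric[of q \<one> x y] by simp
  finally show ?thesis .
qed

lemma left_deriv_stationary:
  assumes f: "f \<in> I_spl N A g V"
  shows "((\<lambda>u. left_deriv f (q \<otimes> chart_inv c0 u) y) has_derivative (\<lambda>_. 0)) (at u0)"
proof -
  have iso: "f \<in> isometries A g" using f by (simp add: I_spl_def)
  note sf = isometry_smooth[OF iso]
  \<comment> \<open>This recenters \<open>f\<close>: \<open>h\<close> fixes the identity, as
    \<open>structure_equation\<close> requires, and its left derivatives are those of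
    \<open>f\<close> at q x.\<close>
  define h where "h = left_diff f q"
  have sh: "smooth_map A A h" unfolding h_def by (rule smooth_left_diff(2)[OF sf])
  have h1: "h \<one> = \<one>" by (simp add: h_def)
  have h_eq: "left_deriv h x = left_deriv f (q \<otimes> x)" for x
    unfolding h_def by (rule left_deriv_left_diff)
  have pz: "left_deriv h p x \<in> \<zz>" if "x \<in> \<zz>" for p x
    using left_deriv_image[OF sf, of "q \<otimes> p" \<zz>] f that by (auto simp: I_spl_def zN_def h_eq)
  have pv: "left_deriv h p x \<in> \<vv>" if "x \<in> \<vv>" for p x
    using left_deriv_image[OF sf, of "q \<otimes> p" \<vv>] f that by (auto simp: I_spl_def vN_def h_eq)
  have pb: "g \<one> (left_deriv h p x) (left_deriv h p y) = g \<one> x y" for p x y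
    unfolding h_eq by (rule left_deriv_isometric[OF iso])
  let ?\<Phi> = "\<lambda>u. left_deriv h (chart_inv c0 u)"
  let ?\<phi> = "left_deriv h \<one>"
  \<comment> \<open>The first argument of \<alpha> is the vector to which the left derivative is
    applied and the second is the direction of differentiation, opposite to the order in the
    overview.\<close>
  define \<alpha> where "\<alpha> y = frechet_derivative (\<lambda>u. ?\<Phi> u y) (at u0)" for y
  have \<alpha>: "((\<lambda>u. ?\<Phi> u y) has_derivative \<alpha> y) (at u0)" for y
    unfolding \<alpha>_def by (rule smooth_on_has_derivative[OF smooth_left_deriv[OF sh c0(1)] X0(2)])
  have lin: "linear ?\<phi>" "linear (\<alpha> y)" "linear (\<lambda>y. \<alpha> y x)" for x y
    using linear_left_deriv[OF sh] has_derivative_linear[OF \<alpha>]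
      linear_parameter_derivative[OF X0 linear_left_deriv[OF sh] \<alpha>] by auto
  note eq = structure_equation[OF sh h1 \<alpha>]
  have sym_z: "\<alpha> x y = \<alpha> y x" if "x \<in> \<zz>" for x y
    using eq[of x y] bracket_center[OF that] bracket_center[OF pz[OF that]] linear_0[OF lin(1)] by simp
  \<comment> \<open>The antisymmetric part of \<alpha> on \<vv> lies in \<vv> as a derivative of
    vectors in \<vv>, and in \<zz> as a difference of central vectors; the two subspaces meet only
    in zero.\<close>
  have sym_v: "\<alpha> x y = \<alpha> y x" if x: "x \<in> \<vv>" and y: "y \<in> \<vv>" for x y
  proof -
    have "\<alpha> x y \<in> \<vv>" "\<alpha> y x \<in> \<vv>"
      using has_derivative_in_subspace[OF \<alpha> splitting(3) X0 pv] x y by auto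
    then have "\<alpha> y x - \<alpha> x y \<in> \<vv>" by (intro subspace_diff splitting(3))
    moreover have "\<alpha> y x - \<alpha> x y = ?\<phi> (lie_bracket N A x y) - lie_bracket N A (?\<phi> x) (?\<phi> y)"
      using eq[of x y] by (simp add: algebra_simps)
    moreover have "\<dots> \<in> \<zz>"
      using two_step pz by (intro subspace_diff subspace_center) (auto simp: two_step_nilpotent_def)
    ultimately show ?thesis using splitting(1) by (metis right_minus_eq)
  qed
  have sym: "\<alpha> x y = \<alpha> y x" for x y
  proof -
    obtain x1 x2 where x: "x1 \<in> \<zz>" "x2 \<in> \<vv>" "x = x1 + x2" using splitting(2)[of x] by blast
    obtain y1 y2 where y: "y1 \<in> \<zz>" "y2 \<in> \<vv>" "y = y1 + y2" using splitting(2)[of y] by blast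
    show ?thesis
      by (simp only: x(3) y(3) linear_add[OF lin(2)] linear_add[OF lin(3)] add_ac
          sym_z[OF x(1), of y1] sym_z[OF x(1), of y2] sym_z[OF y(1), of x2, symmetric] sym_v[OF x(2) y(2)])
  qed
  \<comment> \<open>Differentiating the constant function g (\<phi> x) (\<phi> w) in the direction
    y.\<close>
  have skew: "g \<one> (\<alpha> x y) (?\<phi> w) = - g \<one> (?\<phi> x) (\<alpha> w y)" for x y w
  proof -
    have bb: "bounded_bilinear (g \<one>)"
      using metric_inner_product[of \<one>] by (simp add: inner_product_def bilinear_conv_bounded_bilinear)
    have "((\<lambda>u. g \<one> (?\<Phi> u x) (?\<Phi> u w)) has_derivative
        (\<lambda>y. g \<one> (?\<Phi> u0 x) (\<alpha> w y) + g \<one> (\<alpha> x y) (?\<Phi> u0 w))) (at u0)"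
      by (rule bounded_bilinear.FDERIV[OF bb \<alpha> \<alpha>])
    moreover have "((\<lambda>u. g \<one> (?\<Phi> u x) (?\<Phi> u w)) has_derivative (\<lambda>y. 0)) (at u0)"
      unfolding pb by (rule has_derivative_const)
    ultimately have "(\<lambda>y. g \<one> (?\<Phi> u0 x) (\<alpha> w y) + g \<one> (\<alpha> x y) (?\<Phi> u0 w)) = (\<lambda>y. 0)"
      by (rule has_derivative_unique)
    from fun_cong[OF this, of y] show ?thesis by simp
  qed
  \<comment> \<open>The metric gives skewness in the first and third slots, with the direction of
    differentiation held in the second. Swapping the first two slots by \<open>sym\<close> turns
    this into the skewness in the last two slots that \<open>symmetric_skew_zero\<close>
    expects.\<close>
  have t0: "g \<one> (\<alpha> x y) (?\<phi> w) = 0" for x y w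
  proof (rule symmetric_skew_zero[where t = "\<lambda>x y w. g \<one> (\<alpha> x y) (?\<phi> w)"])
    show "g \<one> (\<alpha> x y) (?\<phi> w) = g \<one> (\<alpha> y x) (?\<phi> w)" for x y w by (simp add: sym[of x y])
    show "g \<one> (\<alpha> x y) (?\<phi> w) = - g \<one> (\<alpha> x w) (?\<phi> y)" for x y w
      using skew[of y x w] sym[of x y] sym[of x w] inner_product_sym[OF metric_inner_product, of \<one> "?\<phi> y" "\<alpha> w x"] by simp
  qed
  have "inj ?\<phi>"
    unfolding linear_injective_0[OF lin(1)]
  proof (intro allI impI)
    fix w assume "?\<phi> w = 0"
    then have "g \<one> w y = 0" for y using pb[of \<one> w y] by (simp add: inner_product_simps[OF metric_inner_product])
    then show "w = 0" using metric_inner_product[of \<one>] by (simp add: inner_product_def)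
  qed
  then have surj: "surj ?\<phi>" by (rule linear_injective_imp_surjective[OF lin(1) _ refl])
  have "\<alpha> y x = 0" for x
  proof -
    have "g \<one> (\<alpha> y x) w = 0" for w
      using t0 surjD[OF surj, of w] by metis
    then show ?thesis using metric_inner_product[of \<one>] by (simp add: inner_product_def)
  qed
  then have "\<alpha> y = (\<lambda>_. 0)" by auto
  with \<alpha>[of y] show ?thesis by (simp add: h_eq)
qed

text \<open>\<open>left_deriv_stationary\<close> gives a zero derivative only at the center
  \<open>u0\<close> of a translated copy of \<open>c0\<close>. It is therefore invoked anew at each
  q of a chart, after a change of coordinates.\<close>

lemma left_deriv_constant:
  assumes f: "f \<in> I_spl N A g V"
  shows "left_deriv f p = left_deriv f q"
proof
  fix y
  show "left_deriv f p y = left_deriv f q y"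
  proof (rule locally_constant_UNIV[OF conn, where f = "\<lambda>p. left_deriv f p y"])
    fix p
    let ?d = "chart_at A p"
    have d: "?d \<in> A" "p \<in> fst ?d" by (rule chart_at[OF manifold])+
    have "((\<lambda>u. left_deriv f (chart_inv ?d u) y) has_derivative (\<lambda>v. 0)) (at (snd ?d q))"
      if q: "q \<in> fst ?d \<inter> UNIV" for q
    proof -
      \<comment> \<open>The transition from the chart around p to \<open>c0\<close> translated so
        that q corresponds to \<open>u0\<close>; the chain rule carries the zero derivative
        across.\<close>
      let ?G = "\<lambda>u. snd c0 (inv q \<otimes> chart_inv ?d u)"
      have G: "(?G has_derivative chart_deriv ?d c0 (\<lambda>x. inv q \<otimes> x) q) (at (snd ?d q))"
        by (rule chart_deriv_works[OF smooth_left d(1) c0(1)]) (use q c0 in auto)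
      have Gq: "?G (snd ?d q) = u0"
        using q chart_inv_left[OF manifold d(1)] by simp
      have "((\<lambda>u. left_deriv f (q \<otimes> chart_inv c0 (?G u)) y) has_derivative (\<lambda>_. 0)) (at (snd ?d q))"
        by (rule has_derivative_compose[where g = "\<lambda>u. left_deriv f (q \<otimes> chart_inv c0 u) y", OF G])
          (simp only: Gq left_deriv_stationary[OF f])
      then show ?thesis
      proof (rule has_derivative_transform_within_open)
        let ?Y = "snd ?d ` (fst ?d \<inter> (\<lambda>x. inv q \<otimes> x) -` fst c0)"
        show "open ?Y" by (rule smooth_map_domain_open[OF manifold manifold smooth_left d(1) c0(1)])
        show "snd ?d q \<in> ?Y" using q c0 by auto
        show "left_deriv f (q \<otimes> chart_inv c0 (?G u)) y = left_deriv f (chart_inv ?d u) y" if "u \<in> ?Y" for u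
          using that by (auto simp: chart_inv_left[OF manifold d(1)] chart_inv_left[OF manifold c0(1)] m_assoc[symmetric])
      qed
    qed
    from chart_zero_derivative_locally_constant[where \<psi> = "\<lambda>p. left_deriv f p y", OF manifold d open_UNIV UNIV_I this]
    show "\<exists>W. open W \<and> p \<in> W \<and> (\<forall>q\<in>W. left_deriv f q y = left_deriv f p y)" by metis
  qed
qed

section \<open>Isometric automorphisms and the group structure\<close>

lemma isometries_compose:
  assumes f: "f \<in> isometries A g" and h: "h \<in> isometries A g"
  shows "(\<lambda>x. h (f x)) \<in> isometries A g"
proof -
  have bij: "bij f" "bij h" using f h by (auto simp: isometries_def)
  have inv: "inv_into UNIV (\<lambda>x. h (f x)) = (\<lambda>x. inv_into UNIV f (inv_into UNIV h x))"
    using o_inv_distrib[OF bij(2,1)] unfolding comp_def .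
  show ?thesis
    unfolding isometries_def mem_Collect_eq inv
  proof (intro conjI allI)
    show "bij (\<lambda>x. h (f x))" using bij_comp[OF bij] by (simp add: comp_def)
    have s: "smooth_map A A f" "smooth_map A A h"
      "smooth_map A A (inv_into UNIV f)" "smooth_map A A (inv_into UNIV h)"
      using f h by (auto simp: isometries_def)
    show "smooth_map A A (\<lambda>x. h (f x))" "smooth_map A A (\<lambda>x. inv_into UNIV f (inv_into UNIV h x))"
      by (rule smooth_map_compose[OF manifold manifold manifold s(1,2)], rule smooth_map_compose[OF manifold manifold manifold s(4,3)])
    fix p u v
    show "g (h (f p)) (mderiv A A (\<lambda>x. h (f x)) p u) (mderiv A A (\<lambda>x. h (f x)) p v) = g p u v"
      using f h by (simp add: isometries_def mderiv_compose[OF manifold manifold manifold s(1,2)])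
  qed
qed

lemma left_mult_isometry: "(\<lambda>x. a \<otimes> x) \<in> isometries A g"
proof -
  have 1: "inv a \<otimes> (a \<otimes> x) = x" "a \<otimes> (inv a \<otimes> x) = x" for x by (simp_all add: m_assoc[symmetric])
  have "bij (\<lambda>x. a \<otimes> x)"
    by (rule bij_betw_byWitness[where f' = "\<lambda>x. inv a \<otimes> x"]) (auto simp: 1)
  moreover have "inv_into UNIV (\<lambda>x. a \<otimes> x) = (\<lambda>x. inv a \<otimes> x)"
    by (rule inv_unique_comp) (auto simp: comp_def 1 id_def)
  ultimately show ?thesis
    by (simp add: isometries_def smooth_left left_mult_isometric)
qed

lemma mderiv_inv_into:
  assumes "bij f" "smooth_map A A f" "smooth_map A A (inv_into UNIV f)"
  shows "mderiv A A (inv_into UNIV f) (f p) (mderiv A A f p u) = u"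
    "mderiv A A f p (mderiv A A (inv_into UNIV f) (f p) w) = w"
proof -
  have *: "inv_into UNIV f (f x) = x" "f (inv_into UNIV f x) = x" for x
    using assms(1) by (simp_all add: bij_is_inj bij_is_surj surj_f_inv_f)
  show "mderiv A A (inv_into UNIV f) (f p) (mderiv A A f p u) = u"
    using mderiv_compose[OF manifold manifold manifold assms(2,3), of p u] by (simp add: * mderiv_id[OF manifold])
  show "mderiv A A f p (mderiv A A (inv_into UNIV f) (f p) w) = w"
    using mderiv_compose[OF manifold manifold manifold assms(3,2), of "f p" w] by (simp add: * mderiv_id[OF manifold])
qed

text \<open>Multiplying \<open>hom\<close> on the left by the inverse of f \<one> makes it
  multiplicativity of h. Thus h is the automorphism and f \<one> determines the translation.\<close>

lemma I_spl_subset_I_aut: "I_spl N A g V \<subseteq> I_aut N A g"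
proof
  fix f assume f: "f \<in> I_spl N A g V"
  then have iso: "f \<in> isometries A g" by (simp add: I_spl_def)
  define h where "h x = inv (f \<one>) \<otimes> f x" for x
  have hom: "f (a \<otimes> x) = f a \<otimes> inv (f \<one>) \<otimes> f x" for a x
    by (rule left_deriv_const_hom[OF isometry_smooth[OF iso] conn left_deriv_constant[OF f]])
  have h: "h \<in> isometries A g"
    unfolding h_def by (rule isometries_compose[OF iso left_mult_isometry])
  moreover have "h \<in> auto N"
    using h by (auto simp: auto_def hom_def Bij_def isometries_def h_def hom m_assoc)
  ultimately have "h \<in> O_group N A g" by (simp add: O_group_def)
  moreover have "f = left_translation N (f \<one>) \<circ> h"
    by (auto simp: left_translation_def h_def m_assoc[symmetric])
  ultimately show "f \<in> I_aut N A g" unfolding I_aut_def by auto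
qed

lemma I_spl_compose:
  assumes "f \<in> I_spl N A g V" "h \<in> I_spl N A g V"
  shows "h \<circ> f \<in> I_spl N A g V"
proof -
  have iso: "f \<in> isometries A g" "h \<in> isometries A g" using assms by (auto simp: I_spl_def)
  have "mderiv A A (\<lambda>x. h (f x)) p ` S = mderiv A A h (f p) ` (mderiv A A f p ` S)" for p S
    by (simp add: image_image mderiv_compose[OF manifold manifold manifold isometry_smooth[OF iso(1)] isometry_smooth[OF iso(2)]])
  then show ?thesis
    using assms isometries_compose[OF iso] by (simp add: I_spl_def comp_def)
qed

lemma I_spl_inv_into:
  assumes f: "f \<in> I_spl N A g V"
  shows "inv_into UNIV f \<in> I_spl N A g V"
proof -
  have iso: "f \<in> isometries A g" using f by (simp add: I_spl_def)
  let ?h = "inv_into UNIV f"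
  have f': "bij f" "smooth_map A A f" "smooth_map A A ?h"
    using iso by (auto simp: isometries_def)
  have *: "?h (f x) = x" "f (?h x) = x" for x
    using f'(1) by (simp_all add: bij_is_inj bij_is_surj surj_f_inv_f)
  have im: "mderiv A A ?h p ` S = T" if "mderiv A A f (?h p) ` T = S" for p S T
    using mderiv_inv_into(1)[OF f', of "?h p"] unfolding that[symmetric] by (simp add: image_image *)
  have "g (?h p) (mderiv A A ?h p u) (mderiv A A ?h p v) = g p u v" for p u v
  proof -
    have "g (f (?h p)) (mderiv A A f (?h p) (mderiv A A ?h p u)) (mderiv A A f (?h p) (mderiv A A ?h p v))
        = g (?h p) (mderiv A A ?h p u) (mderiv A A ?h p v)"
      using iso by (simp add: isometries_def)
    then show ?thesis using mderiv_inv_into(2)[OF f', of "?h p"] by (simp add: *)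
  qed
  moreover have "inv_into UNIV ?h = f" using f'(1) by (rule inv_inv_eq)
  ultimately have "?h \<in> isometries A g"
    using f' by (simp add: isometries_def bij_imp_bij_inv)
  then show ?thesis
    unfolding I_spl_def mem_Collect_eq
  proof (intro conjI allI)
    fix p
    show "mderiv A A ?h p ` zN N A p = zN N A (?h p)"
      by (rule im) (use f in \<open>simp add: I_spl_def *\<close>)
    show "mderiv A A ?h p ` vN N A g V p = vN N A g V (?h p)"
      by (rule im) (use f in \<open>simp add: I_spl_def *\<close>)
  qed
qed

lemma I_spl_id: "(\<lambda>x. x) \<in> I_spl N A g V"
  using left_mult_isometry[of \<one>] by (simp add: I_spl_def mderiv_id[OF manifold])

lemma I_aut_bij: "f \<in> I_aut N A g \<Longrightarrow> bij f"
  unfolding I_aut_def O_group_def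
  using left_mult_isometry
  by (auto simp: isometries_def left_translation_def intro!: bij_comp)

theorem subgroup_I_spl: "subgroup (I_spl N A g V) ((isometry_group A g)\<lparr>carrier := I_aut N A g\<rparr>)"
    (is "subgroup _ ?G")
proof -
  \<comment> \<open>On \<open>UNIV\<close> the extensionality built into \<open>Bij\<close> and the
    restricted composition of \<open>BijGroup\<close> are vacuous, so the operation is ordinary
    composition of bijections.\<close>
  have Bij: "Bij UNIV = {f :: 'g \<Rightarrow> 'g. bij f}" by (auto simp: Bij_def)
  have mult: "x \<otimes>\<^bsub>?G\<^esub> y = x \<circ> y" if "bij x" "bij y" for x y
    using that by (simp add: isometry_group_def BijGroup_def Bij compose_def comp_def restrict_def)
  have one: "\<one>\<^bsub>?G\<^esub> = (\<lambda>x. x)"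
    by (simp add: isometry_group_def BijGroup_def restrict_def)
  have bij: "bij f" if "f \<in> I_spl N A g V" for f
    using I_aut_bij I_spl_subset_I_aut that by blast
  show ?thesis
  proof
    show "I_spl N A g V \<subseteq> carrier ?G" using I_spl_subset_I_aut by simp
    show "\<one>\<^bsub>?G\<^esub> \<in> I_spl N A g V" unfolding one by (rule I_spl_id)
    show "x \<otimes>\<^bsub>?G\<^esub> y \<in> I_spl N A g V" if "x \<in> I_spl N A g V" "y \<in> I_spl N A g V" for x y
      using mult[OF bij bij] I_spl_compose that by simp
    fix x assume x: "x \<in> I_spl N A g V"
    \<comment> \<open>The inverse in a group record is a definite description over its carrier, here
      \<open>I_aut N A g\<close>. It is identified directly: \<open>I_spl_inv_into\<close> and the
      inclusion place the inverse map in that carrier, and its uniqueness is that of an inverse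
      function.\<close>
    have "m_inv ?G x = inv_into UNIV x"
      unfolding m_inv_def
    proof (rule the_equality)
      let ?y = "inv_into UNIV x"
      have y: "?y \<in> I_spl N A g V" using x by (rule I_spl_inv_into)
      have "x \<circ> ?y = (\<lambda>z. z)" "?y \<circ> x = (\<lambda>z. z)"
        using bij[OF x] by (auto simp: bij_is_inj bij_is_surj surj_f_inv_f)
      then show "?y \<in> carrier ?G \<and> x \<otimes>\<^bsub>?G\<^esub> ?y = \<one>\<^bsub>?G\<^esub> \<and> ?y \<otimes>\<^bsub>?G\<^esub> x = \<one>\<^bsub>?G\<^esub>"
        using mult[OF bij[OF x] bij[OF y]] mult[OF bij[OF y] bij[OF x]] one y I_spl_subset_I_aut by auto
      fix w assume w: "w \<in> carrier ?G \<and> x \<otimes>\<^bsub>?G\<^esub> w = \<one>\<^bsub>?G\<^esub> \<and> w \<otimes>\<^bsub>?G\<^esub> x = \<one>\<^bsub>?G\<^esub>"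
      then have "bij w" using I_aut_bij by simp
      then have "x \<circ> w = (\<lambda>z. z)" using w mult[OF bij[OF x]] one by simp
      then show "w = ?y"
        using bij[OF x] by (metis bij_is_inj comp_apply inv_f_eq ext)
    qed
    then show "m_inv ?G x \<in> I_spl N A g V" using I_spl_inv_into[OF x] by simp
  qed
qed

end

theorem proposition5p3:
  fixes N :: "'g::{t2_space,second_countable_topology} monoid"
    and A :: "('g, 'e::euclidean_space) atlas"
    and g :: "'g \<Rightarrow> 'e \<Rightarrow> 'e \<Rightarrow> real"
    and V :: "'e set"
  assumes "lie_group N A"
    and "simply_connected (UNIV :: 'g set)"
    and "two_step_nilpotent N A"
    and "pseudo_riemannian_metric A g"
    and "left_invariant_metric N A g"
    and "admissible_V (g \<one>\<^bsub>N\<^esub>) (lie_center N A) V"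
  shows "subgroup (I_spl N A g V) ((isometry_group A g)\<lparr>carrier := I_aut N A g\<rparr>)"
proof -
  interpret nilpotent_splitting N A g V
    using assms simply_connected_UNIV_imp_connected[OF assms(2)] by unfold_locales auto
  show ?thesis by (rule subgroup_I_spl)
qed

end
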